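(* Let $\gamma$ and $\delta$ be closed geodesics on an orientable hyperbolic surface $M$, and let $l$ and $m$ be distinct geodesics in $\mathbb{H}^2$ above $\gamma$ and $\delta$ respectively. Then the orthogonal projection of $l$ onto $m$ has length strictly less than $l(\gamma)+l(\delta)$.
   Context: A hyperbolic surface is a surface $M=\mathbb{H}^2/\pi_1(M)$ with $\pi_1(M)$ a discrete torsion-free group of isometries of $\mathbb{H}^2$. $l(\gamma)$ denotes the length of a closed geodesic $\gamma$. A geodesic in $\mathbb{H}^2$ above $\gamma$ is a complete geodesic line that is a component of the pre-image of $\gamma$ in $\mathbb{H}^2$. The orthogonal projection of a geodesic line onto another is its image under nearest-point projection; it is an interval of the second line. *)

theory Defs
  imports "HOL-Analysis.Analysis" "HOL-Algebra.Bij"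
begin

section \<open>The hyperbolic plane\<close>

text \<open>The upper half-plane model. The metric is given by
  \<open>sinh (d(z,w) / 2) = |z - w| / (2 sqrt (Im z Im w))\<close>, which is curvature \<open>-1\<close>.\<close>

typedef hyp = "{z::complex. Im z > 0}"
  by (rule exI[of _ \<i>]) simp

lemma Im_Rep_hyp [simp]: "Im (Rep_hyp z) > 0"
  using Rep_hyp[of z] by simp

lemma hyp_triangle_aux:
  fixes z w u :: complex
  assumes "Im z > 0" "Im w > 0" "Im u > 0"
  defines "s \<equiv> \<lambda>z w. cmod (z - w) / (2 * sqrt (Im z * Im w))"
  shows "arsinh (s z u) \<le> arsinh (s z w) + arsinh (s w u)"
proof -
  have c: "sqrt ((s a b)\<^sup>2 + 1) = cmod (a - cnj b) / (2 * sqrt (Im a * Im b))"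
    if "Im a > 0" "Im b > 0" for a b
  proof -
    have "(s a b)\<^sup>2 + 1 = (cmod (a - cnj b) / (2 * sqrt (Im a * Im b)))\<^sup>2"
      using that unfolding s_def
      by (simp add: power_divide power_mult_distrib cmod_power2 divide_simps)
         (simp add: algebra_simps power2_eq_square)
    then show ?thesis using that by simp
  qed
  have ptolemy: "cmod (z - u) * (2 * Im w)
      \<le> cmod (z - w) * cmod (w - cnj u) + cmod (w - u) * cmod (z - cnj w)"
  proof -
    have "cmod (w - cnj w) = 2 * Im w"
      using assms(2) by (simp add: cmod_def real_sqrt_mult)
    moreover have "cmod (u - cnj w) = cmod (w - cnj u)"
      by (metis complex_cnj_cnj complex_cnj_diff complex_mod_cnj norm_minus_commute)
    moreover have "(z - u) * (w - cnj w) = (z - w) * (u - cnj w) + (w - u) * (z - cnj w)"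
      by (simp add: algebra_simps)
    ultimately show ?thesis
      by (metis norm_mult norm_triangle_ineq)
  qed
  define p where "p = sqrt (Im z)"
  define q where "q = sqrt (Im w)"
  define r where "r = sqrt (Im u)"
  have pos: "p > 0" "q > 0" "r > 0" using assms by (auto simp: p_def q_def r_def)
  have q2: "Im w = q * q" using assms by (simp add: q_def)
  have "s z u \<le> s z w * (cmod (w - cnj u) / (2 * sqrt (Im w * Im u)))
       + s w u * (cmod (z - cnj w) / (2 * sqrt (Im z * Im w)))"
    using ptolemy pos unfolding s_def real_sqrt_mult p_def[symmetric] q_def[symmetric] r_def[symmetric]
    unfolding q2 by (simp add: divide_simps) (simp add: algebra_simps)
  also have "\<dots> = sinh (arsinh (s z w) + arsinh (s w u))"
    using c[OF assms(1,2)] c[OF assms(2,3)]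
    by (simp add: sinh_add cosh_arsinh_real mult.commute)
  finally have "arsinh (s z u) \<le> arsinh (sinh (arsinh (s z w) + arsinh (s w u)))"
    by (meson arsinh_less_iff_real not_le)
  then show ?thesis by (simp add: arsinh_sinh_real)
qed

instantiation hyp :: metric_space
begin

definition dist_hyp :: "hyp \<Rightarrow> hyp \<Rightarrow> real" where
  "dist_hyp z w = 2 * arsinh (cmod (Rep_hyp z - Rep_hyp w) / (2 * sqrt (Im (Rep_hyp z) * Im (Rep_hyp w))))"

definition uniformity_hyp :: "(hyp \<times> hyp) filter" where
  "uniformity_hyp = (INF e\<in>{0<..}. principal {(x, y). dist x y < e})"

definition open_hyp :: "hyp set \<Rightarrow> bool" where
  "open_hyp U \<longleftrightarrow> (\<forall>x\<in>U. eventually (\<lambda>(x', y). x' = x \<longrightarrow> y \<in> U) uniformity)"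

instance
proof
  fix x y z :: hyp
  show "dist x y = 0 \<longleftrightarrow> x = y"
    by (simp add: dist_hyp_def Rep_hyp_inject less_imp_neq[OF Im_Rep_hyp, symmetric])
  have sym: "dist a b = dist b a" for a b :: hyp
    by (simp add: dist_hyp_def norm_minus_commute mult.commute)
  have "dist x y \<le> dist x z + dist z y"
    using hyp_triangle_aux[of "Rep_hyp x" "Rep_hyp z" "Rep_hyp y"]
    unfolding dist_hyp_def by simp
  then show "dist x y \<le> dist x z + dist y z"
    by (simp only: sym[of y z])
qed (simp_all add: uniformity_hyp_def open_hyp_def)

end

section \<open>Hyperbolic surfaces\<close>

text \<open>\<open>discrete\<close> refers to the topology of pointwise convergence on \<^typ>\<open>hyp \<Rightarrow> hyp\<close>, which on
  isometries agrees with the compact-open topology.\<close>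

definition hyperbolic_surface_group :: "(hyp \<Rightarrow> hyp) set \<Rightarrow> bool" where
  "hyperbolic_surface_group \<Gamma> \<longleftrightarrow>
     subgroup \<Gamma> (BijGroup UNIV) \<and>
     (\<forall>g\<in>\<Gamma>. \<forall>z w. dist (g z) (g w) = dist z w) \<and>
     discrete \<Gamma> \<and>
     (\<forall>g\<in>\<Gamma>. \<forall>n>0. g ^^ n = id \<longrightarrow> g = id)"

text \<open>The points of the surface \<open>M = H\<^sup>2 / \<Gamma>\<close> are the orbits. Since \<open>\<Gamma>\<close> acts by isometries, the
  quotient metric on \<open>M\<close> is the distance \<^const>\<open>setdist\<close> between orbits as subsets of the plane.\<close>

definition surface_proj :: "(hyp \<Rightarrow> hyp) set \<Rightarrow> hyp \<Rightarrow> hyp set" where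
  "surface_proj \<Gamma> z = (\<lambda>g. g z) ` \<Gamma>"

definition surface :: "(hyp \<Rightarrow> hyp) set \<Rightarrow> hyp set set" where
  "surface \<Gamma> = range (surface_proj \<Gamma>)"

text \<open>An orientation of \<open>M\<close> is a \<open>\<Gamma>\<close>-invariant orientation of the plane, encoded as a continuous
  sign \<open>\<epsilon>\<close> relative to the standard orientation of the complex plane. \<open>Im (cnj (D 1) * D \<i>)\<close> is the
  determinant of the real-linear map \<open>D\<close>.\<close>

definition orientable_surface :: "(hyp \<Rightarrow> hyp) set \<Rightarrow> bool" where
  "orientable_surface \<Gamma> \<longleftrightarrow>
     (\<exists>\<epsilon> :: hyp \<Rightarrow> real. continuous_on UNIV \<epsilon> \<and> range \<epsilon> \<subseteq> {-1, 1} \<and>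
        (\<forall>g\<in>\<Gamma>. \<forall>z. \<exists>D. ((\<lambda>x. Rep_hyp (g (Abs_hyp x))) has_derivative D) (at (Rep_hyp z)) \<and>
           \<epsilon> (g z) * sgn (Im (cnj (D 1) * D \<i>)) = \<epsilon> z))"

text \<open>A closed geodesic of length \<open>L\<close> (not necessarily simple or primitive) is parametrised by arc
  length on the circle \<open>\<real> / L\<int>\<close>, that is, by a locally distance-preserving \<open>L\<close>-periodic map.\<close>

definition closed_geodesic :: "(hyp \<Rightarrow> hyp) set \<Rightarrow> (real \<Rightarrow> hyp set) \<Rightarrow> real \<Rightarrow> bool" where
  "closed_geodesic \<Gamma> \<gamma> L \<longleftrightarrow>
     range \<gamma> \<subseteq> surface \<Gamma> \<and> L > 0 \<and> (\<forall>t. \<gamma> (t + L) = \<gamma> t) \<and>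
     (\<forall>t. \<exists>e>0. \<forall>s\<in>ball t e. \<forall>s'\<in>ball t e. setdist (\<gamma> s) (\<gamma> s') = dist s s')"

section \<open>Geodesic lines in the hyperbolic plane\<close>

definition unit_speed_line :: "(real \<Rightarrow> hyp) \<Rightarrow> bool" where
  "unit_speed_line c \<longleftrightarrow> (\<forall>s t. dist (c s) (c t) = dist s t)"

text \<open>The full pre-image of a closed geodesic with self-intersections is a connected union of
  crossing lines; its components are understood as these lines, i.e. as the complete lifts of the
  closed geodesic.\<close>

definition geodesic_above :: "(hyp \<Rightarrow> hyp) set \<Rightarrow> (real \<Rightarrow> hyp set) \<Rightarrow> hyp set \<Rightarrow> bool" where
  "geodesic_above \<Gamma> \<gamma> l \<longleftrightarrow>
     (\<exists>c. unit_speed_line c \<and> l = range c \<and> (\<forall>t. surface_proj \<Gamma> (c t) = \<gamma> t))"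

definition orth_projection :: "hyp set \<Rightarrow> hyp set \<Rightarrow> hyp set" where
  "orth_projection m A = {p \<in> m. \<exists>z\<in>A. dist z p = infdist z m}"

text \<open>The length, possibly infinite, of an interval \<open>P\<close> of the geodesic line \<open>m\<close>. It does not depend
  on the unit-speed parametrisation: any two differ by an isometry of the real line.\<close>

definition length_on_line :: "hyp set \<Rightarrow> hyp set \<Rightarrow> ennreal" where
  "length_on_line m P =
     emeasure lborel ((SOME c. unit_speed_line c \<and> range c = m) -` P)"

end

(* Conjugate so that m is the imaginary half-line, and let R = (p q; r s) in SL2(R) carry it to l,
   with w = q r and p s = 1 + w. The projection of l onto m has length |ln |(1 + w) / w||. The
   translations A along l and B along m, of lengths a and b, lie in the lift of the group to SL2(R),
   and tr [A,B] = 2 + 16 w (1 + w) sinh(a/2)^2 sinh(b/2)^2.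
   - If tr [A,B] = 2, the lines share an end point, and discreteness forces l = m.
   - If tr [A,B] < 2 (the lines cross), then tr [A,B] <= -2 because the group has no elliptic
     elements, and this is cosh(length/2) <= sinh(a/2) sinh(b/2) < cosh((a+b)/2).
   - If tr [A,B] > 2 (the lines are disjoint), then tr [A,B] >= 3, and this gives
     sinh(length/2) <= 2 sinh(a/2) sinh(b/2) < sinh((a+b)/2). *)

theory Submission
  imports Defs
begin

subsection \<open>Two by two matrices\<close>

text \<open>A torsion-free discrete group only yields \<open>|tr| >= 2\<close>. This keeps the
  commutator trace out of (-2, 2) but would allow it to lie just above 2, so the disjoint case rests
  on a gap. The gap comes from Fricke descent: a Nielsen move from (A, B) to (A B, B) or (A B^-1, B)
  preserves the commutator trace, and while that trace lies in (2, 3), one of the two moves lowers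
  the larger trace by at least 1 in absolute value, which cannot go on for ever. The final estimate
  can afford the constant 3: a gap of 1 costs exactly the factor 2 in
  \<open>2 sinh x sinh y < sinh (x + y)\<close>. Traces belong to SL2(R), while isometries are
  matrices up to sign; a commutator trace does not see the signs. Orientability is what makes the
  translation along a lift a Moebius map instead of a glide reflection. Discreteness is given as
  isolation in the topology of pointwise convergence, and is used in the form that only finitely
  many elements move a given point by at most R.\<close>

datatype mat2 = Mat2 real real real real

instantiation mat2 :: monoid_mult
begin

definition one_mat2 :: mat2 where "1 = Mat2 1 0 0 1"

fun times_mat2 :: "mat2 \<Rightarrow> mat2 \<Rightarrow> mat2" where
  "Mat2 a b c d * Mat2 e f g h = Mat2 (a*e + b*g) (a*f + b*h) (c*e + d*g) (c*f + d*h)"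

instance
proof
  fix A B C :: mat2
  show "A * B * C = A * (B * C)"
    by (cases A; cases B; cases C) (simp add: algebra_simps)
  show "1 * A = A" "A * 1 = A"
    by (cases A; simp add: one_mat2_def)+
qed

end

primrec det2 :: "mat2 \<Rightarrow> real" where "det2 (Mat2 a b c d) = a*d - b*c"
primrec tr2 :: "mat2 \<Rightarrow> real" where "tr2 (Mat2 a b c d) = a + d"
text \<open>The adjugate serves as the inverse: the two agree at determinant 1, and the adjugate is
  linear in the entries, so every product with it stays polynomial.\<close>

primrec adj2 :: "mat2 \<Rightarrow> mat2" where "adj2 (Mat2 a b c d) = Mat2 d (-b) (-c) a"
text \<open>This matrix multiplies by \<open>k^2\<close>; for \<open>k = exp (L / 2)\<close> it is
  the translation of length \<open>L\<close> along the imaginary half-line.\<close>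

definition diag2 :: "real \<Rightarrow> mat2" where "diag2 k = Mat2 k 0 0 (1/k)"
definition comm2 :: "mat2 \<Rightarrow> mat2 \<Rightarrow> mat2" where "comm2 A B = A * B * adj2 A * adj2 B"

lemma det2_mult [simp]: "det2 (A * B) = det2 A * det2 B"
  by (cases A; cases B) (simp add: algebra_simps)

lemma det2_adj2 [simp]: "det2 (adj2 A) = det2 A"
  by (cases A) simp

lemma adj2_adj2 [simp]: "adj2 (adj2 A) = A"
  by (cases A) simp

lemma tr2_adj2 [simp]: "tr2 (adj2 A) = tr2 A"
  by (cases A) simp

lemma adj2_mult [simp]: "adj2 (A * B) = adj2 B * adj2 A"
  by (cases A; cases B) (simp add: algebra_simps)

lemma det2_diag2 [simp]: "k \<noteq> 0 \<Longrightarrow> det2 (diag2 k) = 1"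
  by (simp add: diag2_def)

lemma adj2_inverse:
  assumes "det2 A = 1"
  shows "adj2 A * A = 1" "A * adj2 A = 1"
  using assms by (cases A; simp add: one_mat2_def algebra_simps)+

lemma adj2_cancel:
  assumes "det2 A = 1"
  shows "adj2 A * (A * B) = B" "A * (adj2 A * B) = B"
  using adj2_inverse[OF assms] by (metis mult.assoc mult_1)+

section \<open>Trace identities in SL2(R)\<close>

lemma tr2_commute: "tr2 (A * B) = tr2 (B * A)"
  by (cases A; cases B) (simp add: algebra_simps)

lemma tr2_conj: "det2 P = 1 \<Longrightarrow> tr2 (P * M * adj2 P) = tr2 M"
  by (metis adj2_cancel(1) mult.assoc tr2_commute)

lemma tr2_mult_adj2: "tr2 (A * adj2 B) = tr2 A * tr2 B - tr2 (A * B)"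
  by (cases A; cases B) (simp add: algebra_simps)

text \<open>Fricke's identity. The commutator trace is a polynomial in three traces, which is what
  makes descent on traces possible.\<close>

lemma fricke:
  assumes "det2 A = 1" "det2 B = 1"
  shows "tr2 (comm2 A B) =
    (tr2 A)\<^sup>2 + (tr2 B)\<^sup>2 + (tr2 (A * B))\<^sup>2 - tr2 A * tr2 B * tr2 (A * B) - 2"
proof -
  obtain a b c d e f g h where [simp]: "A = Mat2 a b c d" "B = Mat2 e f g h"
    by (metis mat2.exhaust)
  have "a * d = 1 + b * c" "e * h = 1 + f * g" using assms by auto
  then show ?thesis unfolding comm2_def
    by simp algebra
qed

text \<open>As a quadratic in \<open>tr2 (A * B)\<close>, the Fricke polynomial is symmetric under
  exchange with \<open>tr2 A * tr2 B - tr2 (A * B)\<close>, the trace of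
  \<open>A * adj2 B\<close>.\<close>

lemma tr2_comm2_adj2:
  assumes "det2 A = 1" "det2 B = 1"
  shows "tr2 (comm2 A (adj2 B)) = tr2 (comm2 A B)"
  using assms by (simp add: fricke tr2_mult_adj2 power2_eq_square algebra_simps)

lemma comm2_conj:
  assumes "det2 P = 1"
  shows "comm2 (P * A * adj2 P) (P * B * adj2 P) = P * comm2 A B * adj2 P"
  unfolding comm2_def by (simp add: mult.assoc adj2_cancel[OF assms])

text \<open>The commutator itself is unchanged: in \<open>[A B, B]\<close> the middle factors
  \<open>B B^-1\<close> cancel.\<close>

lemma tr2_comm2_mult:
  assumes "det2 A = 1" "det2 B = 1"
  shows "tr2 (comm2 (A * B) B) = tr2 (comm2 A B)"
proof -
  have "comm2 (A * B) B = A * B * (B * adj2 B) * adj2 A * adj2 B"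
    by (simp add: comm2_def mult.assoc)
  then show ?thesis using assms by (simp add: comm2_def adj2_inverse)
qed

lemma tr2_comm2_commute:
  assumes "det2 A = 1" "det2 B = 1"
  shows "tr2 (comm2 A B) = tr2 (comm2 B A)"
  using assms by (simp add: fricke tr2_commute[of A B])

text \<open>Here \<open>b * c = 0\<close> says that the second element fixes 0 or infinity, the ends
  of the axis of \<open>diag2 k\<close>.\<close>

lemma tr2_comm2_diag2:
  assumes "k \<noteq> 0" "a * d - b * c = 1"
  shows "tr2 (comm2 (diag2 k) (Mat2 a b c d)) = 2 - b * c * (k - 1/k)\<^sup>2"
proof -
  have "a * d = 1 + b * c" using assms by simp
  then show ?thesis using assms(1) unfolding comm2_def diag2_def
    by (simp add: field_simps power2_eq_square)
qed

text \<open>The commutator of \<open>A\<close> and \<open>B\<close> is the product of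
  \<open>A\<close> with the inverse of the conjugate \<open>A'\<close>. This gives the trace of
  \<open>A * A'\<close>, and Fricke's identity for the pair \<open>A\<close>, \<open>A'\<close>
  gives the rest.\<close>

lemma tr2_comm2_conj_self:
  assumes "det2 A = 1" "det2 B = 1"
  defines "A' \<equiv> B * A * adj2 B" and "\<kappa> \<equiv> tr2 (comm2 A B)"
  shows "tr2 (A * A') = (tr2 A)\<^sup>2 - \<kappa>"
    and "tr2 (comm2 A A') = 2 + (\<kappa> - 2) * (\<kappa> + 2 - (tr2 A)\<^sup>2)"
proof -
  have d: "det2 A' = 1" using assms by simp
  have t: "tr2 A' = tr2 A" unfolding A'_def using assms(2) by (rule tr2_conj)
  have "\<kappa> = tr2 (A * adj2 A')" by (simp add: \<kappa>_def comm2_def A'_def mult.assoc)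
  then show 1: "tr2 (A * A') = (tr2 A)\<^sup>2 - \<kappa>"
    by (simp add: tr2_mult_adj2 t power2_eq_square)
  show "tr2 (comm2 A A') = 2 + (\<kappa> - 2) * (\<kappa> + 2 - (tr2 A)\<^sup>2)"
    unfolding fricke[OF assms(1) d] 1 t by (simp add: algebra_simps power2_eq_square)
qed

lemma diagonalize2:
  assumes "det2 A = 1" "\<bar>tr2 A\<bar> > 2"
  obtains P k where "det2 P = 1" "\<bar>k\<bar> > 1" "A = P * diag2 k * adj2 P"
proof -
  obtain a b c d where A: "A = Mat2 a b c d" by (cases A)
  define t where "t = a + d"
  have ad: "a * d - b * c = 1" and t2: "\<bar>t\<bar> > 2" using assms A t_def by auto
  define D where "D = sqrt (t\<^sup>2 - 4)"
  have "t\<^sup>2 > 2\<^sup>2"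
    using t2 power_strict_mono[of 2 "\<bar>t\<bar>" 2] by simp
  then have D2: "D\<^sup>2 = t\<^sup>2 - 4" and Dpos: "D > 0"
    by (simp_all add: D_def)
  \<comment> \<open>The eigenvalues have product 1; taking the square root with the sign of
    \<open>t\<close> selects the one of larger absolute value.\<close>
  define k where "k = (if t > 0 then (t + D)/2 else (t - D)/2)"
  have k1: "\<bar>k\<bar> > 1" using t2 Dpos by (auto simp: k_def)
  have kk: "k*k - t*k + 1 = 0"
    using D2 by (auto simp: k_def field_simps power2_eq_square)
  have ki: "1/k = t - k" using kk k1 by (auto simp: field_simps)
  have kne: "k - 1/k \<noteq> 0" using k1 kk ki D2 Dpos
    by (auto simp: k_def)
  have "\<exists>P. det2 P \<noteq> 0 \<and> A * P = P * diag2 k"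
  proof (cases "c = 0")
    case False
    have "det2 (Mat2 (k - d) (1/k - d) c c) = c * (k - 1/k)" by (simp add: algebra_simps)
    moreover have "A * Mat2 (k - d) (1/k - d) c c = Mat2 (k - d) (1/k - d) c c * diag2 k"
      using kk ad unfolding A diag2_def ki by (auto simp: t_def algebra_simps)
    ultimately show ?thesis using False kne by (metis mult_eq_0_iff)
  next
    case True
    then have "(k - a) * (k - d) = 0" using kk ad by (auto simp: t_def) algebra
    then consider "k = a" | "k = d" by auto
    then show ?thesis
    proof cases
      case 1
      then have "1/k = d" using ki t_def by simp
      then show ?thesis using True 1 kne
        by (intro exI[of _ "Mat2 1 b 0 (d - a)"]) (auto simp: A diag2_def algebra_simps)
    next
      case 2
      then have "1/k = a" using ki t_def by simp
      then show ?thesis using True 2 kne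
        by (intro exI[of _ "Mat2 b 1 (d - a) 0"]) (auto simp: A diag2_def algebra_simps)
    qed
  qed
  then obtain P where P: "det2 P \<noteq> 0" "A * P = P * diag2 k" by blast
  obtain p q r s where Pe: "P = Mat2 p q r s" by (cases P)
  define e where "e = det2 P"
  \<comment> \<open>Rescaling one eigenvector makes the determinant 1 and keeps both columns
    eigenvectors.\<close>
  define Q where "Q = Mat2 p (q / e) r (s / e)"
  have e: "e \<noteq> 0" "e = p * s - q * r" using P(1) by (auto simp: e_def Pe)
  have "det2 Q = (p * s - q * r) / e" by (simp add: Q_def diff_divide_distrib)
  then have "det2 Q = 1" using e by simp
  moreover have "A * Q = Q * diag2 k"
    using P(2) e(1) unfolding A Q_def Pe diag2_def
    by (auto simp: divide_simps)
  then have "A = Q * diag2 k * adj2 Q"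
    using \<open>det2 Q = 1\<close> by (metis adj2_inverse(2) mult.assoc mult_1_right)
  ultimately show thesis using that k1 by blast
qed

subsection \<open>Moebius transformations and geodesic lines\<close>

lemma Im_Rep_hyp_nonzero [simp]: "Im (Rep_hyp z) \<noteq> 0"
  using Im_Rep_hyp[of z] by linarith

primrec mobc :: "mat2 \<Rightarrow> complex \<Rightarrow> complex" where
  "mobc (Mat2 a b c d) z = (of_real a * z + of_real b) / (of_real c * z + of_real d)"

definition mob :: "mat2 \<Rightarrow> hyp \<Rightarrow> hyp" where
  "mob M z = Abs_hyp (mobc M (Rep_hyp z))"

definition iaxis :: "real \<Rightarrow> hyp" where
  "iaxis t = Abs_hyp (Complex 0 (exp t))"

lemma mobc_denominator_nonzero:
  assumes "a * d - b * c = 1" "Im z > 0"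
  shows "of_real c * z + of_real d \<noteq> 0"
proof
  assume h: "of_real c * z + of_real d = 0"
  have "c * Im z = Im (of_real c * z + of_real d)" by simp
  then have "c * Im z = 0" using h by simp
  with assms have "c = 0" by simp
  with h assms show False by simp
qed

lemma Im_mobc:
  assumes "a * d - b * c = 1" "Im z > 0"
  shows "Im (mobc (Mat2 a b c d) z) = Im z / (cmod (of_real c * z + of_real d))\<^sup>2"
proof -
  have ad: "a * d = 1 + b * c" using assms by simp
  have "(a * Im z) * (c * Re z + d) - (a * Re z + b) * (c * Im z) = Im z"
    using ad by algebra
  then show ?thesis by (simp add: Im_divide cmod_power2)
qed

lemma Rep_mob:
  assumes "det2 M = 1"
  shows "Rep_hyp (mob M z) = mobc M (Rep_hyp z)"
proof (cases M)
  case (Mat2 a b c d)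
  then have "Im (mobc M (Rep_hyp z)) > 0"
    using assms mobc_denominator_nonzero[of a d b c "Rep_hyp z"]
    by (simp add: Im_mobc del: mobc.simps)
  then show ?thesis by (simp add: mob_def Abs_hyp_inverse)
qed

lemma mob_mult:
  assumes "det2 A = 1" "det2 B = 1"
  shows "mob (A * B) z = mob A (mob B z)"
proof -
  obtain a b c d where A: "A = Mat2 a b c d" by (cases A)
  obtain e f g h where B: "B = Mat2 e f g h" by (cases B)
  define w where "w = Rep_hyp z"
  have n1: "of_real g * w + of_real h \<noteq> (0::complex)"
    using mobc_denominator_nonzero[of e h f g w] assms(2) by (simp add: B w_def)
  have "Im (mobc B w) > 0" using Rep_mob[OF assms(2), of z] Im_Rep_hyp w_def by metis
  then have n2: "of_real c * mobc B w + of_real d \<noteq> (0::complex)"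
    using mobc_denominator_nonzero[of a d b c] assms(1) by (simp add: A)
  have eq: "of_real c * mobc B w + of_real d = (of_real (c*e + d*g) * w + of_real (c*f + d*h)) / (of_real g * w + of_real h)"
     "of_real a * mobc B w + of_real b = (of_real (a*e + b*g) * w + of_real (a*f + b*h)) / (of_real g * w + of_real h)"
    using n1 by (simp_all add: B field_simps)
  have "mobc (A * B) w = mobc A (mobc B w)"
    using n1 n2 unfolding A mobc.simps eq by (simp add: B)
  then have "Rep_hyp (mob (A * B) z) = Rep_hyp (mob A (mob B z))"
    using assms by (simp add: Rep_mob w_def)
  then show ?thesis by (simp add: Rep_hyp_inject)
qed

lemma mob_one [simp]: "mob 1 z = z"
  by (simp add: mob_def one_mat2_def Rep_hyp_inverse)

lemma mob_adj2:
  assumes "det2 A = 1"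
  shows "mob (adj2 A) (mob A z) = z" "mob A (mob (adj2 A) z) = z"
  using assms by (simp_all flip: mob_mult add: adj2_inverse)

text \<open>The hyperbolic cosine of the distance is rational in the coordinates, without roots or
  \<open>arsinh\<close>. Distances are compared through it, since \<open>cosh\<close> is strictly
  increasing on nonnegative reals.\<close>

lemma cosh_dist:
  "cosh (dist z w) = 1 + (cmod (Rep_hyp z - Rep_hyp w))\<^sup>2 / (2 * Im (Rep_hyp z) * Im (Rep_hyp w))"
proof -
  define u where "u = cmod (Rep_hyp z - Rep_hyp w) / (2 * sqrt (Im (Rep_hyp z) * Im (Rep_hyp w)))"
  have "u\<^sup>2 = (cmod (Rep_hyp z - Rep_hyp w))\<^sup>2 / (4 * Im (Rep_hyp z) * Im (Rep_hyp w))"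
    by (simp add: u_def power_divide power_mult_distrib zero_le_mult_iff less_imp_le)
  moreover have "cosh (dist z w) = 1 + 2 * u\<^sup>2"
    by (simp add: dist_hyp_def u_def[symmetric] cosh_double cosh_arsinh_real)
  ultimately show ?thesis by simp
qed

lemma dist_eq_iff_cosh_hyp:
  fixes z w z' w' :: hyp
  shows "dist z w = dist z' w' \<longleftrightarrow> cosh (dist z w) = cosh (dist z' w')"
  by (metis cosh_real_nonneg_less_iff linorder_neq_iff zero_le_dist)

lemma mob_isometry:
  assumes "det2 M = 1"
  shows "dist (mob M z) (mob M w) = dist z w"
proof -
  obtain a b c d where M: "M = Mat2 a b c d" by (cases M)
  have det: "a * d - b * c = 1" using assms M by simp
  define x where "x = Rep_hyp z"
  define y where "y = Rep_hyp w"
  have pos: "Im x > 0" "Im y > 0" by (simp_all add: x_def y_def)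
  have nz: "of_real c * x + of_real d \<noteq> 0" "of_real c * y + of_real d \<noteq> 0"
    using mobc_denominator_nonzero[OF det] pos by auto
  have dc: "of_real a * of_real d - of_real b * of_real c = (1::complex)"
    using det by (metis of_real_1 of_real_diff of_real_mult)
  have "(of_real a * x + of_real b) * (of_real c * y + of_real d) - (of_real a * y + of_real b) * (of_real c * x + of_real d)
     = (x - y) * (of_real a * of_real d - of_real b * of_real c)" by (simp add: algebra_simps)
  then have "mobc M x - mobc M y = (x - y) / ((of_real c * x + of_real d) * (of_real c * y + of_real d))"
    using nz by (simp add: M dc divide_simps)
  then have n: "cmod (mobc M x - mobc M y) =
      cmod (x - y) / (cmod (of_real c * x + of_real d) * cmod (of_real c * y + of_real d))"
    by (simp only: norm_divide norm_mult)
  have im: "Im (mobc M x) = Im x / (cmod (of_real c * x + of_real d))\<^sup>2"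
    "Im (mobc M y) = Im y / (cmod (of_real c * y + of_real d))\<^sup>2"
    unfolding M using Im_mobc[OF det] pos by auto
  have "(cmod (mobc M x - mobc M y))\<^sup>2 / (2 * Im (mobc M x) * Im (mobc M y))
      = (cmod (x - y))\<^sup>2 / (2 * Im x * Im y)"
    unfolding n im using nz pos by (simp add: power_divide power_mult_distrib)
  then show ?thesis
    using assms unfolding dist_eq_iff_cosh_hyp cosh_dist x_def y_def by (simp add: Rep_mob)
qed

lemma Rep_iaxis [simp]: "Rep_hyp (iaxis t) = Complex 0 (exp t)"
  by (simp add: iaxis_def Abs_hyp_inverse)

lemma cosh_dist_iaxis:
  "cosh (dist z (iaxis t)) = ((cmod (Rep_hyp z))\<^sup>2 + exp (2*t)) / (2 * Im (Rep_hyp z) * exp t)"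
proof -
  have "(cmod (Rep_hyp z - Complex 0 (exp t)))\<^sup>2
      = (cmod (Rep_hyp z))\<^sup>2 + exp (2*t) - 2 * Im (Rep_hyp z) * exp t"
    unfolding cmod_power2 exp_double by (simp add: power2_eq_square algebra_simps)
  then show ?thesis using Im_Rep_hyp[of z]
    by (simp add: cosh_dist divide_simps)
qed

lemma dist_iaxis [simp]: "dist (iaxis s) (iaxis t) = \<bar>s - t\<bar>"
proof -
  have "cosh (dist (iaxis s) (iaxis t)) = cosh (s - t)"
    unfolding cosh_dist_iaxis exp_double Rep_iaxis cmod_power2
    by (simp add: cosh_def[of "s - t"] exp_diff exp_minus power2_eq_square field_simps)
  then have "cosh (dist (iaxis s) (iaxis t)) = cosh \<bar>s - t\<bar>" by simp
  then show ?thesis by (metis abs_ge_zero cosh_real_nonneg_less_iff linorder_neq_iff zero_le_dist)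
qed

text \<open>The distance to \<open>iaxis r\<close> gives a linear equation in \<open>|z|^2\<close>
  and \<open>Im z\<close>. Two values of \<open>r\<close> determine both, and
  \<open>|z|^2 = (Im z)^2\<close> leaves no real part.\<close>

lemma iaxis_unique:
  assumes "s \<noteq> t" "dist z (iaxis s) = \<bar>u - s\<bar>" "dist z (iaxis t) = \<bar>u - t\<bar>"
  shows "z = iaxis u"
proof -
  define y where "y = Im (Rep_hyp z)"
  define \<rho> where "\<rho> = (cmod (Rep_hyp z))\<^sup>2"
  have y: "y > 0" by (simp add: y_def)
  have *: "\<rho> + (exp r)\<^sup>2 = y * (exp u + (exp r)\<^sup>2 / exp u)" if "dist z (iaxis r) = \<bar>u - r\<bar>" for r
  proof -
    have "(\<rho> + (exp r)\<^sup>2) / (2 * y * exp r) = (exp u / exp r + exp r / exp u) / 2"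
    proof -
      have "cosh (u - r) = (exp u / exp r + exp r / exp u) / 2"
        by (simp add: cosh_def exp_diff exp_minus)
      then show ?thesis
        using cosh_dist_iaxis[of z r] unfolding that cosh_real_abs exp_double \<rho>_def y_def by simp
    qed
    moreover have "\<rho> + (exp r)\<^sup>2 = (\<rho> + (exp r)\<^sup>2) / (2 * y * exp r) * (2 * y * exp r)"
      using y by simp
    ultimately have "\<rho> + (exp r)\<^sup>2 = (exp u / exp r + exp r / exp u) / 2 * (2 * y * exp r)"
      by metis
    also have "\<dots> = y * (exp u + (exp r)\<^sup>2 / exp u)"
      by (simp add: field_simps power2_eq_square)
    finally show ?thesis .
  qed
  note eqs = *[OF assms(2)] *[OF assms(3)]
  have "(exp s)\<^sup>2 - (exp t)\<^sup>2 = (y / exp u) * ((exp s)\<^sup>2 - (exp t)\<^sup>2)"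
    using eqs by (simp add: field_simps)
  moreover have "(exp s)\<^sup>2 \<noteq> (exp t)\<^sup>2" using assms(1) by (simp flip: exp_double)
  ultimately have "y / exp u = 1" by (metis diff_eq_diff_eq diff_self eq_iff_diff_eq_0 mult_cancel_right1)
  then have yu: "y = exp u" by simp
  with eqs(1) have "\<rho> = (exp u)\<^sup>2" by (simp add: field_simps power2_eq_square)
  then have "Re (Rep_hyp z) = 0" by (simp add: \<rho>_def cmod_power2 flip: y_def yu)
  then have "Rep_hyp z = Rep_hyp (iaxis u)" using yu by (simp add: complex_eq_iff y_def)
  then show ?thesis by (simp only: Rep_hyp_inject)
qed

lemma mob_iaxis_0:
  obtains T where "det2 T = 1" "mob T (iaxis 0) = z"
proof -
  define x where "x = Re (Rep_hyp z)"
  define y where "y = sqrt (Im (Rep_hyp z))"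
  have y: "y > 0" "y * y = Im (Rep_hyp z)" using less_imp_le[OF Im_Rep_hyp[of z]] by (simp_all add: y_def)
  \<comment> \<open>The affine map sending \<open>w\<close> to \<open>Im z * w + Re z\<close>; as
    \<open>y\<close> is the square root of \<open>Im z\<close>, the determinant is 1.\<close>
  define T where "T = Mat2 y (x/y) 0 (1/y)"
  have d: "det2 T = 1" using y by (simp add: T_def)
  have "Rep_hyp (mob T (iaxis 0)) = Rep_hyp z"
    using y unfolding Rep_mob[OF d] by (simp add: T_def complex_eq_iff Re_divide Im_divide x_def power2_eq_square flip: y(2))
  then show ?thesis using that d by (simp add: Rep_hyp_inject)
qed

lemma mob_pair:
  obtains P where "det2 P = 1" "mob P (iaxis 0) = z" "mob P (iaxis (dist z w)) = w"
proof -
  obtain T where T: "det2 T = 1" "mob T (iaxis 0) = z" by (rule mob_iaxis_0)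
  define v where "v = Rep_hyp (mob (adj2 T) w)"
  \<comment> \<open>A rotation about \<open>i\<close> by the matrix \<open>K\<close> below makes the
    real part of \<open>v\<close> proportional to
    \<open>cos (2\<theta>) * Re v + sin (2\<theta>) * (1 - |v|^2) / 2\<close>. With
    \<open>\<theta>\<close> half the argument of \<open>n\<close>, this vanishes.\<close>
  define n where "n = Complex ((1 - (cmod v)\<^sup>2) / 2) (- Re v)"
  define \<theta> where "\<theta> = Arg n / 2"
  have n: "(1 - (cmod v)\<^sup>2) / 2 = cmod n * cos (2*\<theta>)" "- Re v = cmod n * sin (2*\<theta>)"
    using rcis_cmod_Arg[of n] by (auto simp: \<theta>_def n_def rcis_def complex_eq_iff)
  define K where "K = Mat2 (cos \<theta>) (sin \<theta>) (- sin \<theta>) (cos \<theta>)"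
  have K: "det2 K = 1" by (simp add: K_def flip: power2_eq_square)
  have "Im v > 0" by (simp add: v_def)
  have "(cos \<theta> * Re v + sin \<theta>) * (- sin \<theta> * Re v + cos \<theta>) + cos \<theta> * Im v * (- sin \<theta> * Im v)
    = cos (2*\<theta>) * Re v + sin (2*\<theta>) * ((1 - (cmod v)\<^sup>2) / 2)"
    unfolding cos_double sin_double cmod_power2 by (simp add: field_simps power2_eq_square)
  also have "\<dots> = 0" using n by algebra
  finally have "Re (mobc K v) = 0"
    by (simp add: K_def Re_divide algebra_simps)
  define k where "k = mob K (mob (adj2 T) w)"
  have "Re (Rep_hyp k) = 0" using \<open>Re (mobc K v) = 0\<close> by (simp add: k_def Rep_mob[OF K] v_def)
  then have k: "k = iaxis (ln (Im (Rep_hyp k)))"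
    by (simp add: complex_eq_iff flip: Rep_hyp_inject)
  define u where "u = ln (Im (Rep_hyp k))"
  have K0: "mob K (iaxis 0) = iaxis 0"
    by (simp add: Rep_mob[OF K] flip: Rep_hyp_inject)
       (auto simp: K_def complex_eq_iff Re_divide Im_divide simp flip: power2_eq_square)
  have "dist w z = dist (mob K (mob (adj2 T) w)) (mob K (mob (adj2 T) z))"
    using T K by (simp add: mob_isometry)
  also have "mob (adj2 T) z = iaxis 0" using T mob_adj2 by metis
  finally have r: "dist z w = \<bar>u\<bar>" by (metis K0 dist_iaxis dist_commute diff_zero k k_def u_def)
  show ?thesis
  proof (cases "u \<ge> 0")
    case True
    have "mob (T * adj2 K) (iaxis 0) = z"
      using T K K0 mob_adj2(1)[OF K, of "iaxis 0"] by (simp add: mob_mult)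
    moreover have "mob (T * adj2 K) (iaxis u) = w"
      using k k_def u_def T K mob_adj2 by (metis det2_adj2 mob_mult)
    ultimately show ?thesis using that[of "T * adj2 K"] T K True r by simp
  next
    case False
    \<comment> \<open>The image of \<open>w\<close> lies on the half-line below \<open>i\<close>;
      the half-turn about \<open>i\<close> moves it above.\<close>
    define J where "J = Mat2 0 (-1) 1 0"
    have J: "det2 J = 1" by (simp add: J_def)
    have Ja: "mob J (iaxis t) = iaxis (- t)" for t
      by (simp add: Rep_mob[OF J] flip: Rep_hyp_inject)
         (auto simp: J_def complex_eq_iff Re_divide Im_divide exp_minus field_simps power2_eq_square)
    have "mob (T * adj2 K * J) (iaxis 0) = z"
      using T K K0 J Ja[of 0] mob_adj2(1)[OF K, of "iaxis 0"] by (simp add: mob_mult)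
    moreover have "mob (T * adj2 K * J) (iaxis (-u)) = w"
      using k k_def u_def T K J Ja mob_adj2 by (metis det2_adj2 det2_mult minus_minus mob_mult mult_1)
    ultimately show ?thesis using that[of "T * adj2 K * J"] T K J False r by simp
  qed
qed

text \<open>A Moebius map can be adjusted at the parameters 0 and 1, and the distances to these two
  points determine all others.\<close>

lemma unit_speed_line_normal_form:
  assumes "unit_speed_line c"
  obtains P where "det2 P = 1" "\<And>t. c t = mob P (iaxis t)"
proof -
  obtain P where P: "det2 P = 1" "mob P (iaxis 0) = c 0" "mob P (iaxis (dist (c 0) (c 1))) = c 1"
    by (rule mob_pair)
  have 1: "dist (c 0) (c 1) = 1" using assms by (simp add: unit_speed_line_def)
  have "mob (adj2 P) (c t) = iaxis t" for t
  proof (rule iaxis_unique[of 0 1])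
    have "dist (mob (adj2 P) (c t)) (iaxis s) = dist (c t) (mob P (iaxis s))" for s
      using mob_isometry[OF P(1), of "mob (adj2 P) (c t)" "iaxis s"] P(1) by (simp add: mob_adj2)
    then show "dist (mob (adj2 P) (c t)) (iaxis 0) = \<bar>t - 0\<bar>" "dist (mob (adj2 P) (c t)) (iaxis 1) = \<bar>t - 1\<bar>"
      using P 1 assms by (auto simp: unit_speed_line_def dist_real_def)
  qed simp
  then have "c t = mob P (iaxis t)" for t using P(1) by (metis mob_adj2(2))
  then show ?thesis using that P by blast
qed

lemma unit_speed_line_eq:
  assumes "unit_speed_line c" "unit_speed_line c'" "s \<noteq> t" "c s = c' s" "c t = c' t"
  shows "c u = c' u"
proof -
  obtain P where P: "det2 P = 1" "\<And>t. c t = mob P (iaxis t)"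
    using unit_speed_line_normal_form[OF assms(1)] by blast
  have "mob (adj2 P) (c' u) = iaxis u"
  proof (rule iaxis_unique[OF assms(3)])
    have "dist (mob (adj2 P) (c' u)) (iaxis r) = dist (c' u) (c r)" for r
      using mob_isometry[OF P(1), of "mob (adj2 P) (c' u)" "iaxis r"] P by (simp add: mob_adj2)
    then show "dist (mob (adj2 P) (c' u)) (iaxis s) = \<bar>u - s\<bar>" "dist (mob (adj2 P) (c' u)) (iaxis t) = \<bar>u - t\<bar>"
      using assms by (auto simp: unit_speed_line_def dist_real_def)
  qed
  then show ?thesis using P by (metis mob_adj2(2))
qed

subsection \<open>Topology and isometries of the hyperbolic plane\<close>

text \<open>The topology on \<open>hyp\<close> comes from the hyperbolic metric; this continuity
  imports connectedness and compactness from the complex plane.\<close>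

lemma continuous_on_Abs_hyp: "continuous_on {w. Im w > 0} Abs_hyp"
  unfolding continuous_on
proof
  fix w :: complex assume w: "w \<in> {w. Im w > 0}"
  have "((\<lambda>x. 2 * arsinh (cmod (x - w) / (2 * sqrt (Im x * Im w)))) \<longlongrightarrow>
      2 * arsinh (cmod (w - w) / (2 * sqrt (Im w * Im w)))) (at w within {w. Im w > 0})"
    by (rule tendsto_intros | use w in simp)+
  then have "((\<lambda>x. 2 * arsinh (cmod (x - w) / (2 * sqrt (Im x * Im w)))) \<longlongrightarrow> 0) (at w within {w. Im w > 0})"
    by simp
  moreover have "\<forall>\<^sub>F x in at w within {w. Im w > 0}.
      2 * arsinh (cmod (x - w) / (2 * sqrt (Im x * Im w))) = dist (Abs_hyp x) (Abs_hyp w)"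
    using w by (auto simp: eventually_at_filter dist_hyp_def Abs_hyp_inverse)
  ultimately have "((\<lambda>x. dist (Abs_hyp x) (Abs_hyp w)) \<longlongrightarrow> 0) (at w within {w. Im w > 0})"
    by (rule Lim_transform_eventually)
  then show "(Abs_hyp \<longlongrightarrow> Abs_hyp w) (at w within {w. Im w > 0})"
    by (rule tendsto_dist_iff[THEN iffD2])
qed

lemma connected_hyp: "connected (UNIV :: hyp set)"
proof -
  have "(UNIV :: hyp set) = Abs_hyp ` {w. Im w > 0}"
    by (metis Rep_hyp Rep_hyp_inverse UNIV_eq_I image_eqI)
  then show ?thesis
    by (metis continuous_on_Abs_hyp connected_continuous_image convex_connected convex_halfspace_Im_gt)
qed

lemma cball_hyp_finite_cover:
  fixes z :: hyp
  assumes "\<epsilon> > 0"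
  obtains K where "finite K" "\<And>w. dist w z \<le> R \<Longrightarrow> \<exists>k\<in>K. dist w k < \<epsilon>"
proof -
  define H where "H = cosh (R + dist z (iaxis 0))"
  have H1: "H \<ge> 1" by (simp add: H_def cosh_real_ge_1)
  \<comment> \<open>With \<open>x\<close>, \<open>y\<close> the coordinates of a point of the ball,
    the bound on the distance to \<open>i\<close> becomes \<open>x^2 + y^2 + 1 <= 2 H y\<close>.
    This confines the point to a rectangle away from the real line.\<close>
  define C where "C = cbox (Complex (- (2*H)) (1/(2*H))) (Complex (2*H) (2*H))"
  have "C \<subseteq> {w. Im w > 0}"
    using H1 less_le_trans[of 0 "1 / (2 * H)"] by (auto simp: C_def in_cbox_complex_iff)
  then have "compact (Abs_hyp ` C)"
    unfolding C_def
    by (intro compact_continuous_image continuous_on_subset[OF continuous_on_Abs_hyp] compact_cbox)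
  then have "seq_compact (Abs_hyp ` C)" by (rule compact_imp_seq_compact)
  from seq_compact_imp_totally_bounded[OF this, rule_format, OF assms]
  obtain K where K: "finite K" "Abs_hyp ` C \<subseteq> (\<Union>x\<in>K. ball x \<epsilon>)" by blast
  have "\<exists>k\<in>K. dist w k < \<epsilon>" if "dist w z \<le> R" for w
  proof -
    define y where "y = Im (Rep_hyp w)"
    define x where "x = Re (Rep_hyp w)"
    have y: "y > 0" by (simp add: y_def)
    have "dist w (iaxis 0) \<le> R + dist z (iaxis 0)"
      using dist_triangle[of w "iaxis 0" z] that by simp
    then have "cosh (dist w (iaxis 0)) \<le> H"
      unfolding H_def by (subst cosh_real_nonneg_le_iff) (auto intro: order_trans[OF zero_le_dist])
    then have le: "x\<^sup>2 + y\<^sup>2 + 1 \<le> 2 * H * y"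
      unfolding cosh_dist_iaxis using y by (simp add: cmod_power2 divide_simps flip: x_def y_def)
    have "y * y \<le> 2 * H * y"
      using le zero_le_power2[of x] unfolding power2_eq_square by linarith
    then have y2: "y \<le> 2 * H" using y by simp
    have y1: "1 \<le> 2 * H * y" using le zero_le_power2[of x] zero_le_power2[of y] by linarith
    have "x\<^sup>2 \<le> (2 * H) * (2 * H)" using le zero_le_power2[of y] mult_left_mono[OF y2, of "2 * H"] H1 by linarith
    then have "x\<^sup>2 \<le> (2 * H)\<^sup>2" by (simp only: power2_eq_square)
    then have "\<bar>x\<bar> \<le> 2 * H" unfolding abs_le_square_iff[symmetric] using H1 by simp
    then have "Rep_hyp w \<in> C"
      using y1 y2 H1 unfolding C_def in_cbox_complex_iff by (auto simp: divide_simps abs_le_iff mult.commute simp flip: x_def y_def)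
    then have "w \<in> Abs_hyp ` C" by (metis Rep_hyp_inverse image_eqI)
    then obtain k where "k \<in> K" "w \<in> ball k \<epsilon>" using K(2) by blast
    then show ?thesis by (auto simp: dist_commute)
  qed
  then show ?thesis using that K by blast
qed

section \<open>Isometries fixing the imaginary half-line, and orientation\<close>

definition refl_hyp :: "hyp \<Rightarrow> hyp" where
  "refl_hyp z = Abs_hyp (- cnj (Rep_hyp z))"

lemma Rep_refl_hyp: "Rep_hyp (refl_hyp z) = - cnj (Rep_hyp z)"
  by (simp add: refl_hyp_def Abs_hyp_inverse)

text \<open>Distances to the axis determine each image up to reflection. The choice is uniform: if
  \<open>z\<close> were reflected and \<open>w\<close> fixed, both off the axis, equality of
  \<open>dist (refl_hyp z) w\<close> and \<open>dist z w\<close> would make the product of their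
  real parts 0.\<close>

lemma isometry_fixing_iaxis:
  assumes iso: "\<And>z w. dist (f z) (f w) = dist z w"
    and fixed: "\<And>t. f (iaxis t) = iaxis t"
  shows "f = id \<or> f = refl_hyp"
proof -
  have 1: "f z = z \<or> f z = refl_hyp z" for z
  proof -
    define y y' where "y = Im (Rep_hyp z)" and "y' = Im (Rep_hyp (f z))"
    define r r' where "r = (cmod (Rep_hyp z))\<^sup>2" and "r' = (cmod (Rep_hyp (f z)))\<^sup>2"
    have pos: "y > 0" "y' > 0" by (simp_all add: y_def y'_def)
    have *: "(r' + exp (2*t)) * y = (r + exp (2*t)) * y'" for t
    proof -
      have "cosh (dist (f z) (iaxis t)) = cosh (dist z (iaxis t))" by (metis iso fixed)
      then show ?thesis unfolding cosh_dist_iaxis r_def[symmetric] r'_def[symmetric] y_def[symmetric] y'_def[symmetric]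
        using pos by (simp add: divide_simps)
    qed
    have e: "(r' + 1) * y = (r + 1) * y'" "(r' + exp 2) * y = (r + exp 2) * y'" using *[of 0] *[of 1] by simp_all
    then have "(exp 2 - 1) * (y - y') = 0" by algebra
    then have yy: "y = y'" by simp
    then have "r = r'" using e pos by simp
    then have "(Re (Rep_hyp z))\<^sup>2 = (Re (Rep_hyp (f z)))\<^sup>2"
      using yy by (simp add: r_def r'_def cmod_power2 flip: y_def y'_def)
    then show ?thesis using yy
      by (auto simp: power2_eq_iff complex_eq_iff Rep_refl_hyp y_def y'_def simp flip: Rep_hyp_inject)
  qed
  show ?thesis
  proof (rule ccontr)
    assume "\<not> ?thesis"
    then obtain z w where z: "f z \<noteq> z" and w: "f w \<noteq> refl_hyp w" by (auto simp: fun_eq_iff)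
    then have zw: "f z = refl_hyp z" "f w = w" using 1 by blast+
    then have nz: "Re (Rep_hyp z) \<noteq> 0" "Re (Rep_hyp w) \<noteq> 0"
      using z w by (auto simp: complex_eq_iff Rep_refl_hyp simp flip: Rep_hyp_inject)
    have "cosh (dist (refl_hyp z) w) = cosh (dist z w)" by (metis iso zw)
    then have "(cmod (- cnj (Rep_hyp z) - Rep_hyp w))\<^sup>2 = (cmod (Rep_hyp z - Rep_hyp w))\<^sup>2"
      unfolding cosh_dist Rep_refl_hyp by simp
    then have "(Re (Rep_hyp z) + Re (Rep_hyp w))\<^sup>2 = (Re (Rep_hyp z) - Re (Rep_hyp w))\<^sup>2"
      unfolding cmod_power2 by (simp add: power2_eq_square algebra_simps)
    then show False using nz by (simp add: power2_eq_square algebra_simps)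
  qed
qed

lemma mob_diag2_iaxis: "mob (diag2 (exp (L / 2))) (iaxis t) = iaxis (t + L)"
proof -
  have "exp L = exp (L / 2) * exp (L / 2)" by (simp flip: exp_add)
  then have "Rep_hyp (mob (diag2 (exp (L / 2))) (iaxis t)) = Rep_hyp (iaxis (t + L))"
    by (simp add: Rep_mob) (simp add: diag2_def complex_eq_iff Re_divide Im_divide exp_add)
  then show ?thesis by (simp only: Rep_hyp_inject)
qed

lemma refl_hyp_mob:
  assumes "a * d - b * c = 1"
  shows "refl_hyp (mob (Mat2 a b c d) z) = mob (Mat2 a (- b) (- c) d) (refl_hyp z)"
proof -
  have "Rep_hyp (refl_hyp (mob (Mat2 a b c d) z)) = Rep_hyp (mob (Mat2 a (- b) (- c) d) (refl_hyp z))"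
    unfolding Rep_refl_hyp using assms by (simp add: Rep_mob Rep_refl_hyp minus_divide_left)
  then show ?thesis by (simp only: Rep_hyp_inject)
qed

lemma mob_eq_id:
  assumes d: "det2 M = 1" and id: "\<And>z. mob M z = z"
  shows "M = 1 \<or> M = Mat2 (-1) 0 0 (-1)"
proof -
  obtain a b c d where M: "M = Mat2 a b c d" by (cases M)
  have det: "a * d - b * c = 1" using d M by simp
  have *: "b = - c * y\<^sup>2" "a = d" if "y > 0" for y
  proof -
    define z where "z = Abs_hyp (Complex 0 y)"
    have z: "Rep_hyp z = Complex 0 y" using that by (simp add: z_def Abs_hyp_inverse)
    have "mobc M (Rep_hyp z) = Rep_hyp z" using id[of z] Rep_mob[OF d] by metis
    then have "of_real a * Complex 0 y + of_real b = Complex 0 y * (of_real c * Complex 0 y + of_real d)"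
      using mobc_denominator_nonzero[OF det, of "Complex 0 y"] that unfolding M z
      by (simp add: divide_eq_eq split: if_splits)
    then show "b = - c * y\<^sup>2" "a = d"
      using that by (auto simp: complex_eq_iff power2_eq_square)
  qed
  have "b = 0" "c = 0" "a = d" using *[of 1] *[of 2] by auto
  then have "a\<^sup>2 = 1" using det by (simp add: power2_eq_square)
  then show ?thesis using \<open>b = 0\<close> \<open>c = 0\<close> \<open>a = d\<close> by (auto simp: M one_mat2_def power2_eq_1_iff)
qed

text \<open>By the chain rule \<open>D h = - cnj h / v^2\<close>, a reflection followed by
  multiplication by a complex number.\<close>

lemma mob_refl_orientation_reversing:
  assumes d: "det2 M = 1"
    and D: "((\<lambda>x. Rep_hyp (mob M (refl_hyp (Abs_hyp x)))) has_derivative D) (at (Rep_hyp z))"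
  shows "Im (cnj (D 1) * D \<i>) < 0"
proof -
  obtain a b c d where M: "M = Mat2 a b c d" by (cases M)
  have det: "a * d - b * c = 1" using d M by simp
  define w where "w = Rep_hyp z"
  define v where "v = of_real c * (- cnj w) + of_real d"
  have v: "v \<noteq> 0" using mobc_denominator_nonzero[OF det, of "- cnj w"] by (simp add: v_def w_def)
  have dc: "of_real a * of_real d - of_real b * of_real c = (1::complex)"
    using arg_cong[OF det, of complex_of_real] by simp
  define u where "u = - cnj w"
  have "((\<lambda>x. (of_real a * x + of_real b) / (of_real c * x + of_real d)) has_field_derivative
      (of_real a * v - (of_real a * u + of_real b) * of_real c) / (v * v)) (at u)"
    using v unfolding v_def u_def[symmetric]
    by (auto intro!: derivative_eq_intros)
  moreover have "of_real a * v - (of_real a * u + of_real b) * of_real c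
      = of_real a * of_real d - of_real b * of_real c"
    unfolding v_def u_def[symmetric] by (simp add: algebra_simps)
  ultimately have "((\<lambda>x. (of_real a * x + of_real b) / (of_real c * x + of_real d)) has_field_derivative
      1 / v\<^sup>2) (at u)"
    unfolding dc power2_eq_square by simp
  then have "((\<lambda>x. (of_real a * x + of_real b) / (of_real c * x + of_real d)) has_derivative
      (\<lambda>h. 1 / v\<^sup>2 * h)) (at u)"
    unfolding has_field_derivative_def .
  moreover have "((\<lambda>x. - cnj x) has_derivative (\<lambda>h. - cnj h)) (at w)"
    by (auto intro!: derivative_eq_intros)
  ultimately have "((\<lambda>x. (of_real a * (- cnj x) + of_real b) / (of_real c * (- cnj x) + of_real d)) has_derivative
      (\<lambda>h. - cnj h / v\<^sup>2)) (at w)"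
    using has_derivative_compose[of "\<lambda>x. - cnj x" "\<lambda>h. - cnj h" w UNIV] unfolding u_def by fastforce
  then have "((\<lambda>x. Rep_hyp (mob M (refl_hyp (Abs_hyp x)))) has_derivative (\<lambda>h. - cnj h / v\<^sup>2)) (at w)"
  proof (rule has_derivative_transform_within_open[of _ _ _ _ "{x. Im x > 0}"])
    show "open {x. Im x > 0}" by (rule open_halfspace_Im_gt)
    show "w \<in> {x. Im x > 0}" by (simp add: w_def)
    fix x assume "x \<in> {x. Im x > 0}"
    then have R: "Rep_hyp (refl_hyp (Abs_hyp x)) = - cnj x" by (simp add: Rep_refl_hyp Abs_hyp_inverse)
    show "(of_real a * (- cnj x) + of_real b) / (of_real c * (- cnj x) + of_real d) = Rep_hyp (mob M (refl_hyp (Abs_hyp x)))"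
      unfolding Rep_mob[OF d] R unfolding M mobc.simps by (rule refl)
  qed
  then have "D = (\<lambda>h. - cnj h / v\<^sup>2)" using D has_derivative_unique unfolding w_def by blast
  then have "cnj (D 1) * D \<i> = - \<i> * (cnj (1/v\<^sup>2) * (1/v\<^sup>2))" by simp
  also have "cnj (1/v\<^sup>2) * (1/v\<^sup>2) = of_real ((cmod (1/v\<^sup>2))\<^sup>2)"
    by (metis complex_norm_square mult.commute)
  finally show ?thesis using v by simp
qed

subsection \<open>Discreteness\<close>

locale surface_group =
  fixes \<Gamma> :: "(hyp \<Rightarrow> hyp) set"
  assumes surface_group: "hyperbolic_surface_group \<Gamma>"
    and orientable: "orientable_surface \<Gamma>"
begin

lemma isometry: "g \<in> \<Gamma> \<Longrightarrow> dist (g z) (g w) = dist z w"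
  using surface_group by (simp add: hyperbolic_surface_group_def)

lemma torsion_free: "g \<in> \<Gamma> \<Longrightarrow> n > 0 \<Longrightarrow> g ^^ n = id \<Longrightarrow> g = id"
  using surface_group by (simp add: hyperbolic_surface_group_def)

lemma subgroup_Bij: "subgroup \<Gamma> (BijGroup UNIV)"
  using surface_group by (simp add: hyperbolic_surface_group_def)

lemma bij_carrier: "g \<in> \<Gamma> \<Longrightarrow> bij g"
  using subgroup.subset[OF subgroup_Bij] by (auto simp: BijGroup_def Bij_def)

lemma id_in: "id \<in> \<Gamma>"
  using subgroup.one_closed[OF subgroup_Bij] by (simp add: BijGroup_def id_def restrict_def)

lemma comp_in:
  assumes "g \<in> \<Gamma>" "h \<in> \<Gamma>"
  shows "g \<circ> h \<in> \<Gamma>"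
proof -
  have "g \<otimes>\<^bsub>BijGroup UNIV\<^esub> h = g \<circ> h"
    using bij_carrier[OF assms(1)] bij_carrier[OF assms(2)]
    by (simp add: BijGroup_def Bij_def compose_def comp_def restrict_def)
  then show ?thesis using subgroup.m_closed[OF subgroup_Bij assms] by simp
qed

lemma inverse_in:
  assumes "g \<in> \<Gamma>"
  obtains h where "h \<in> \<Gamma>" "h \<circ> g = id" "g \<circ> h = id"
proof -
  define h where "h = inv\<^bsub>BijGroup UNIV\<^esub> g"
  have h: "h \<in> \<Gamma>" unfolding h_def using subgroup.m_inv_closed[OF subgroup_Bij assms] .
  have gc: "g \<in> carrier (BijGroup UNIV)" using subgroup.subset[OF subgroup_Bij] assms by blast
  have "h \<otimes>\<^bsub>BijGroup UNIV\<^esub> g = \<one>\<^bsub>BijGroup UNIV\<^esub>"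
    unfolding h_def using group.l_inv[OF group_BijGroup gc] .
  then have hg: "h \<circ> g = id"
    using bij_carrier[OF assms] bij_carrier[OF h]
    by (simp add: BijGroup_def Bij_def compose_def comp_def id_def restrict_def)
  then have "g \<circ> h = id"
    using bij_carrier[OF assms] by (metis bij_is_surj comp_assoc comp_id fun.map_id surj_iff)
  then show ?thesis using that h hg by blast
qed

lemma funpow_in: "g \<in> \<Gamma> \<Longrightarrow> g ^^ n \<in> \<Gamma>"
  by (induction n) (auto simp: id_in comp_in simp flip: id_def)

text \<open>A basic neighbourhood of \<open>id\<close> for pointwise convergence constrains only
  finitely many points, here \<open>F\<close>.\<close>

lemma discrete_at_id:
  obtains F \<epsilon> where "finite F" "\<epsilon> > 0" "\<And>g. g \<in> \<Gamma> \<Longrightarrow> (\<And>x. x \<in> F \<Longrightarrow> dist (g x) x < \<epsilon>) \<Longrightarrow> g = id"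
proof -
  have "id isolated_in \<Gamma>"
    using surface_group id_in by (auto simp: hyperbolic_surface_group_def discrete_def)
  then obtain U where U: "open U" "U \<inter> \<Gamma> = {id}" by (auto simp: isolated_in_def)
  then have "openin (product_topology (\<lambda>i. euclidean) UNIV) U" "id \<in> U"
    by (auto simp: open_fun_def)
  then obtain X where X: "id \<in> (\<Pi>\<^sub>E i\<in>UNIV. X i)" "\<And>i. open (X i)"
      "finite {i. X i \<noteq> UNIV}" "(\<Pi>\<^sub>E i\<in>UNIV. X i) \<subseteq> U"
    using product_topology_open_contains_basis[of "\<lambda>i. euclidean" UNIV U id] by auto
  define F where "F = {i. X i \<noteq> UNIV}"
  have "\<exists>e>0. ball x e \<subseteq> X x" for x
  proof -
    have "x \<in> X x" using X(1) by (auto simp: PiE_iff)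
    then show ?thesis using X(2)[of x] unfolding open_contains_ball by blast
  qed
  then obtain e where e: "\<And>x. e x > 0" "\<And>x. ball x (e x) \<subseteq> X x" by metis
  \<comment> \<open>The inserted 1 keeps the minimum meaningful and positive when \<open>F\<close>
    is empty.\<close>
  define \<epsilon> where "\<epsilon> = Min (insert 1 (e ` F))"
  have F: "finite F" using X(3) F_def by simp
  have \<epsilon>: "\<epsilon> > 0" "\<And>x. x \<in> F \<Longrightarrow> \<epsilon> \<le> e x"
    using F e(1) by (auto simp: \<epsilon>_def)
  have "g = id" if g: "g \<in> \<Gamma>" "\<And>x. x \<in> F \<Longrightarrow> dist (g x) x < \<epsilon>" for g
  proof -
    have "g x \<in> X x" for x
    proof (cases "x \<in> F")
      case True
      then have "g x \<in> ball x (e x)" using g(2)[OF True] \<epsilon>(2)[OF True] by (simp add: dist_commute)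
      then show ?thesis using e(2) by blast
    qed (simp add: F_def)
    then have "g \<in> U" using X(4) by auto
    then show ?thesis using U(2) g(1) by blast
  qed
  then show ?thesis using that F \<epsilon>(1) by blast
qed

text \<open>Pigeonhole on finite nets: if \<open>g\<close> and \<open>h\<close> send each point of
  \<open>F\<close> close to the same net point, then \<open>h^-1 g\<close> moves every point of
  \<open>F\<close> by less than \<open>\<epsilon>\<close> and is the identity.\<close>

lemma properly_discontinuous: "finite {g \<in> \<Gamma>. dist (g z) z \<le> R}"
proof -
  obtain F \<epsilon> where F: "finite F" "\<epsilon> > 0"
      "\<And>g. g \<in> \<Gamma> \<Longrightarrow> (\<And>x. x \<in> F \<Longrightarrow> dist (g x) x < \<epsilon>) \<Longrightarrow> g = id"
    using discrete_at_id by blast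
  define R' where "R' x = R + dist x z" for x
  have "\<exists>K. finite K \<and> (\<forall>w. dist w z \<le> R' x \<longrightarrow> (\<exists>k\<in>K. dist w k < \<epsilon>/2))" for x
    using cball_hyp_finite_cover[of "\<epsilon>/2" z "R' x"] F(2) by (metis half_gt_zero)
  then obtain K where K: "\<And>x. finite (K x)"
      "\<And>x w. dist w z \<le> R' x \<Longrightarrow> \<exists>k\<in>K x. dist w k < \<epsilon>/2" by metis
  define c where "c x w = (SOME k. k \<in> K x \<and> dist w k < \<epsilon>/2)" for x w
  have c: "c x w \<in> K x \<and> dist w (c x w) < \<epsilon>/2" if "dist w z \<le> R' x" for x w
    unfolding c_def using K(2)[OF that] by (intro someI_ex[of "\<lambda>k. k \<in> K x \<and> dist w k < \<epsilon>/2"]) blast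
  define S where "S = {g \<in> \<Gamma>. dist (g z) z \<le> R}"
  have bound: "dist (g x) z \<le> R' x" if "g \<in> S" for g x
    using that dist_triangle[of "g x" z "g z"] isometry[of g x z] by (simp add: S_def R'_def)
  define \<Phi> where "\<Phi> g = (\<lambda>x\<in>F. c x (g x))" for g
  have "\<Phi> ` S \<subseteq> (\<Pi>\<^sub>E x\<in>F. K x)" using c bound by (auto simp: \<Phi>_def)
  then have "finite (\<Phi> ` S)" using finite_PiE[OF F(1)] K(1) finite_subset by blast
  moreover have "inj_on \<Phi> S"
  proof (rule inj_onI)
    fix g h assume gh: "g \<in> S" "h \<in> S" "\<Phi> g = \<Phi> h"
    then have "g \<in> \<Gamma>" "h \<in> \<Gamma>" by (auto simp: S_def)
    obtain h' where h': "h' \<in> \<Gamma>" "h' \<circ> h = id" "h \<circ> h' = id"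
      using inverse_in[OF \<open>h \<in> \<Gamma>\<close>] by blast
    have "h' \<circ> g = id"
    proof (rule F(3)[OF comp_in[OF h'(1) \<open>g \<in> \<Gamma>\<close>]])
      fix x assume x: "x \<in> F"
      have ceq: "c x (g x) = c x (h x)" using fun_cong[OF gh(3), of x] x by (simp add: \<Phi>_def)
      have "dist ((h' \<circ> g) x) x = dist (h' (g x)) (h' (h x))"
        using fun_cong[OF h'(2), of x] by simp
      also have "\<dots> = dist (g x) (h x)" using isometry[OF h'(1)] .
      also have "\<dots> \<le> dist (g x) (c x (g x)) + dist (h x) (c x (g x))" by (rule dist_triangle2)
      also have "\<dots> < \<epsilon>" using c[OF bound[OF gh(1)], of x] c[OF bound[OF gh(2)], of x] ceq by simp
      finally show "dist ((h' \<circ> g) x) x < \<epsilon>" .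
    qed
    then show "g = h" using h'(3) by (metis comp_assoc comp_id id_comp)
  qed
  ultimately show ?thesis unfolding S_def[symmetric] using finite_imageD by blast
qed

text \<open>Orientability enters here. The sign \<open>\<epsilon>\<close> is constant on the
  connected plane, while an orientation-reversing element would have to change it.\<close>

lemma not_orientation_reversing:
  assumes g: "g \<in> \<Gamma>" and M: "det2 M = 1"
  shows "g \<noteq> mob M \<circ> refl_hyp"
proof
  assume eq: "g = mob M \<circ> refl_hyp"
  obtain \<epsilon> :: "hyp \<Rightarrow> real" where \<epsilon>: "continuous_on UNIV \<epsilon>" "range \<epsilon> \<subseteq> {-1, 1}"
    "\<And>g z. g \<in> \<Gamma> \<Longrightarrow> \<exists>D. ((\<lambda>x. Rep_hyp (g (Abs_hyp x))) has_derivative D) (at (Rep_hyp z)) \<and>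
           \<epsilon> (g z) * sgn (Im (cnj (D 1) * D \<i>)) = \<epsilon> z"
    using orientable unfolding orientable_surface_def by blast
  have "\<epsilon> constant_on UNIV"
    using continuous_finite_range_constant[OF connected_hyp \<epsilon>(1)] \<epsilon>(2) finite_subset by blast
  then obtain s where s: "\<And>z. \<epsilon> z = s" by (auto simp: constant_on_def)
  with \<epsilon>(2) have "s \<noteq> 0" by auto
  obtain D where D: "((\<lambda>x. Rep_hyp (g (Abs_hyp x))) has_derivative D) (at (Rep_hyp (iaxis 0)))"
      "\<epsilon> (g (iaxis 0)) * sgn (Im (cnj (D 1) * D \<i>)) = \<epsilon> (iaxis 0)"
    using \<epsilon>(3)[OF g] by blast
  have "Im (cnj (D 1) * D \<i>) < 0"
    using mob_refl_orientation_reversing[OF M] D(1)[unfolded eq comp_def] by blast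
  then have "sgn (Im (cnj (D 1) * D \<i>)) = -1" by (rule sgn_neg)
  then have "- s = s" using D(2) by (metis s mult_minus1_right)
  with \<open>s \<noteq> 0\<close> show False by simp
qed

text \<open>The full preimage in SL2(R), containing \<open>-M\<close> along with \<open>M\<close>,
  so that no signs have to be chosen.\<close>

definition lift :: "mat2 set" where
  "lift = {M. det2 M = 1 \<and> mob M \<in> \<Gamma>}"

lemma lift_det: "M \<in> lift \<Longrightarrow> det2 M = 1"
  by (simp add: lift_def)

lemma lift_mult:
  assumes "A \<in> lift" "B \<in> lift"
  shows "A * B \<in> lift"
proof -
  have "mob (A * B) = mob A \<circ> mob B" using assms by (auto simp: lift_def mob_mult)
  then show ?thesis using assms comp_in by (simp add: lift_def)
qed

lemma lift_adj2:
  assumes "A \<in> lift"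
  shows "adj2 A \<in> lift"
proof -
  have A: "det2 A = 1" "mob A \<in> \<Gamma>" using assms by (auto simp: lift_def)
  obtain h where h: "h \<in> \<Gamma>" "h \<circ> mob A = id" using inverse_in[OF A(2)] by blast
  have "h z = mob (adj2 A) z" for z
    using fun_cong[OF h(2), of "mob (adj2 A) z"] by (simp add: mob_adj2[OF A(1)])
  then have "h = mob (adj2 A)" by blast
  then show ?thesis using h A by (simp add: lift_def)
qed

text \<open>All powers of \<open>g\<close> fix \<open>z\<close>, so by proper discontinuity there
  are finitely many of them and \<open>g\<close> has finite order.\<close>

lemma fixed_point_imp_id:
  assumes "g \<in> \<Gamma>" "g z = z"
  shows "g = id"
proof -
  have "(g ^^ n) z = z" for n using assms(2) by (induction n) auto
  then have "range (\<lambda>n. g ^^ n) \<subseteq> {g \<in> \<Gamma>. dist (g z) z \<le> 0}" using funpow_in[OF assms(1)] by auto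
  then have "finite (range (\<lambda>n. g ^^ n))" using properly_discontinuous finite_subset by blast
  then have "\<not> inj (\<lambda>n. g ^^ n)" using finite_imageD by fastforce
  then obtain m n where mn: "g ^^ m = g ^^ n" "m < n"
    by (metis injI linorder_neqE_nat)
  have "(g ^^ m) ((g ^^ (n - m)) x) = (g ^^ m) x" for x
  proof -
    have "g ^^ n = g ^^ m \<circ> g ^^ (n - m)" using mn(2) by (simp flip: funpow_add)
    then show ?thesis using mn(1) by (metis comp_apply)
  qed
  then have "g ^^ (n - m) = id"
    using bij_is_inj[OF bij_carrier[OF funpow_in[OF assms(1)]]] by (auto simp: fun_eq_iff inj_eq)
  then show ?thesis using torsion_free[OF assms(1), of "n - m"] mn(2) by simp
qed

lemma lift_not_elliptic:
  assumes "M \<in> lift"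
  shows "\<bar>tr2 M\<bar> \<ge> 2"
proof (rule ccontr)
  assume tr: "\<not> \<bar>tr2 M\<bar> \<ge> 2"
  obtain a b c d where M: "M = Mat2 a b c d" by (cases M)
  have d: "det2 M = 1" "mob M \<in> \<Gamma>" using assms by (auto simp: lift_def)
  have det: "a * d - b * c = 1" using d M by simp
  have "\<bar>a + d\<bar> < 2" using tr M by simp
  then have lt: "(a + d)\<^sup>2 < 4" using power_strict_mono[of "\<bar>a + d\<bar>" 2 2] by simp
  have id4: "(a - d)\<^sup>2 + 4 * b * c = (a + d)\<^sup>2 - 4" using det by algebra
  have c: "c \<noteq> 0" using id4 lt zero_le_power2[of "a - d"] by fastforce
  \<comment> \<open>\<open>Complex r s\<close> is the root in the upper half-plane of
    \<open>c z^2 + (d - a) z - b\<close>, whose discriminant is \<open>(a + d)^2 - 4 < 0\<close>. It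
    is a fixed point of \<open>M\<close>.\<close>
  define s where "s = sqrt (4 - (a + d)\<^sup>2) / (2 * \<bar>c\<bar>)"
  define r where "r = (a - d) / (2 * c)"
  have s: "s > 0" using lt c by (simp add: s_def)
  have s2: "4 * c\<^sup>2 * s\<^sup>2 = 4 - (a + d)\<^sup>2" using lt c by (simp add: s_def power_divide power_mult_distrib)
  have r: "2 * c * r = a - d" using c by (simp add: r_def)
  define z where "z = Abs_hyp (Complex r s)"
  have z: "Rep_hyp z = Complex r s" using s by (simp add: z_def Abs_hyp_inverse)
  have "4 * c * (c * (r\<^sup>2 - s\<^sup>2) + (d - a) * r - b) = 0" using s2 r id4 by algebra
  then have re: "c * (r\<^sup>2 - s\<^sup>2) + (d - a) * r - b = 0" using c by simp
  have "of_real a * Complex r s + of_real b = Complex r s * (of_real c * Complex r s + of_real d)"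
  proof -
    have "a * r + b = r * (c * r + d) - s * (c * s)" using re by (simp add: algebra_simps power2_eq_square)
    moreover have "a * s = r * (c * s) + s * (c * r + d)" using r by algebra
    ultimately show ?thesis by (simp add: complex_eq_iff)
  qed
  then have "mobc M (Rep_hyp z) = Rep_hyp z"
    using mobc_denominator_nonzero[OF det, of "Complex r s"] s unfolding M z
    by (simp add: divide_eq_eq split: if_splits)
  then have "mob M z = z" by (simp add: Rep_mob[OF d(1)] flip: Rep_hyp_inject)
  then have "mob M = id" using fixed_point_imp_id d(2) by blast
  then have "M = 1 \<or> M = Mat2 (-1) 0 0 (-1)" using mob_eq_id[OF d(1)] by simp
  then show False using tr by (auto simp: one_mat2_def)
qed


text \<open>The sum of squares of the entries is \<open>2 * cosh\<close> of the distance by which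
  \<open>M\<close> moves \<open>i\<close>, so a bound on it bounds a displacement. Passing from
  matrices to isometries is at most two-to-one.\<close>

lemma finite_conj_bounded:
  assumes P: "det2 P = 1"
  shows "finite {M. det2 M = 1 \<and> mob (P * M * adj2 P) \<in> \<Gamma> \<and>
    (\<exists>a b c d. M = Mat2 a b c d \<and> a\<^sup>2 + b\<^sup>2 + c\<^sup>2 + d\<^sup>2 \<le> B)}"
proof -
  define S where "S = {M. det2 M = 1 \<and> mob (P * M * adj2 P) \<in> \<Gamma> \<and>
    (\<exists>a b c d. M = Mat2 a b c d \<and> a\<^sup>2 + b\<^sup>2 + c\<^sup>2 + d\<^sup>2 \<le> B)}"
  define z where "z = mob P (iaxis 0)"
  define \<Phi> where "\<Phi> M = mob (P * M * adj2 P)" for M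
  have "\<Phi> M \<in> {g \<in> \<Gamma>. dist (g z) z \<le> B}" if M: "M \<in> S" for M
  proof -
    obtain a b c d where Me: "M = Mat2 a b c d" "a\<^sup>2 + b\<^sup>2 + c\<^sup>2 + d\<^sup>2 \<le> B" using M by (auto simp: S_def)
    have dM: "det2 M = 1" using M by (simp add: S_def)
    then have det: "a * d - b * c = 1" using Me by simp
    have zeq: "\<Phi> M z = mob P (mob M (iaxis 0))"
      using P dM by (simp add: \<Phi>_def z_def mob_mult mob_adj2)
    have nz: "c\<^sup>2 + d\<^sup>2 > 0"
      using det by (metis diff_zero mult_zero_right not_sum_power2_lt_zero sum_power2_gt_zero_iff zero_neq_one)
    have im: "Im (Rep_hyp (mob M (iaxis 0))) = 1 / (c\<^sup>2 + d\<^sup>2)"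
      unfolding Rep_mob[OF dM] unfolding Me(1) by (subst Im_mobc[OF det]) (auto simp: cmod_power2 add.commute)
    have cm: "(cmod (Rep_hyp (mob M (iaxis 0))))\<^sup>2 = (a\<^sup>2 + b\<^sup>2) / (c\<^sup>2 + d\<^sup>2)"
      unfolding Rep_mob[OF dM] unfolding Me(1) by (simp add: norm_divide power_divide cmod_power2 add.commute)
    have "dist (\<Phi> M z) z = dist (mob M (iaxis 0)) (iaxis 0)"
      unfolding zeq by (simp add: z_def mob_isometry[OF P])
    moreover have "cosh (dist (mob M (iaxis 0)) (iaxis 0)) = (a\<^sup>2 + b\<^sup>2 + c\<^sup>2 + d\<^sup>2) / 2"
    proof -
      have "(u / n + 1) / (2 * (1 / n)) = (u + n) / 2" if "n > 0" for u n :: real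
        using that by (simp add: field_simps)
      from this[OF nz, of "a\<^sup>2 + b\<^sup>2"] show ?thesis
        unfolding cosh_dist_iaxis im cm by (simp add: add.assoc)
    qed
    ultimately have "cosh (dist (\<Phi> M z) z) \<le> B / 2" using Me(2) by simp
    then have "exp (dist (\<Phi> M z) z) \<le> B"
    proof -
      have "exp (dist (\<Phi> M z) z) + exp (- dist (\<Phi> M z) z) = 2 * cosh (dist (\<Phi> M z) z)"
        by (simp add: cosh_def)
      moreover have "exp (- dist (\<Phi> M z) z) > 0" by simp
      ultimately show ?thesis using \<open>cosh (dist (\<Phi> M z) z) \<le> B / 2\<close> by linarith
    qed
    then have "dist (\<Phi> M z) z \<le> B" using exp_ge_add_one_self[of "dist (\<Phi> M z) z"] by linarith
    then show ?thesis using M by (simp add: \<Phi>_def S_def)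
  qed
  then have "\<Phi> ` S \<subseteq> {g \<in> \<Gamma>. dist (g z) z \<le> B}" by blast
  then have fin: "finite (\<Phi> ` S)" using properly_discontinuous by (rule finite_subset)
  have "finite {M \<in> S. \<Phi> M = \<Phi> N}" if N: "N \<in> S" for N
  proof -
    have "M \<in> {N, N * Mat2 (-1) 0 0 (-1)}" if M: "M \<in> S" "\<Phi> M = \<Phi> N" for M
    proof -
      have dN: "det2 N = 1" and dM: "det2 M = 1" using N M by (auto simp: S_def)
      have "mob (adj2 N * M) w = w" for w
      proof -
        have "mob P (mob M w) = mob P (mob N w)"
          using fun_cong[OF M(2), of "mob P w"] P dM dN by (simp add: \<Phi>_def mob_mult mob_adj2)
        then have "mob M w = mob N w" by (metis P mob_adj2(1))
        then show ?thesis using dM dN by (simp add: mob_mult mob_adj2)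
      qed
      then have "adj2 N * M = 1 \<or> adj2 N * M = Mat2 (-1) 0 0 (-1)"
        using mob_eq_id dM dN by simp
      then show ?thesis using adj2_cancel(2)[OF dN, of M] by auto
    qed
    then have "{M \<in> S. \<Phi> M = \<Phi> N} \<subseteq> {N, N * Mat2 (-1) 0 0 (-1)}" by blast
    then show ?thesis by (rule finite_subset) simp
  qed
  then have "finite S" using pigeonhole_infinite[of S \<Phi>] fin by blast
  then show ?thesis by (simp only: S_def)
qed

text \<open>Both elements fix infinity in the coordinates of \<open>P\<close>. Each conjugation by
  the inverse of the first divides \<open>q\<close> by \<open>k^2\<close> and keeps the diagonal, so
  \<open>q \<noteq> 0\<close> would give infinitely many bounded matrices.\<close>

lemma shared_fixed_point_aux:
  assumes P: "det2 P = 1" and k: "\<bar>k\<bar> > 1" and A: "P * diag2 k * adj2 P \<in> lift"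
    and B: "P * Mat2 p q 0 s * adj2 P \<in> lift"
  shows "q = 0"
proof (rule ccontr)
  assume q: "q \<noteq> 0"
  define f where "f n = Mat2 p (q / k ^ (2 * n)) 0 s" for n
  have k0: "k \<noteq> 0" using k by auto
  have f: "P * f n * adj2 P \<in> lift" for n
  proof (induction n)
    case 0
    then show ?case using B by (simp add: f_def)
  next
    case (Suc n)
    have "adj2 (P * diag2 k * adj2 P) * (P * f n * adj2 P) * (P * diag2 k * adj2 P) \<in> lift"
      using A Suc lift_mult lift_adj2 by blast
    also have "adj2 (P * diag2 k * adj2 P) * (P * f n * adj2 P) * (P * diag2 k * adj2 P)
        = P * (adj2 (diag2 k) * f n * diag2 k) * adj2 P"
      by (simp add: mult.assoc adj2_cancel[OF P])
    also have "adj2 (diag2 k) * f n * diag2 k = f (Suc n)"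
      using k0 by (simp add: f_def diag2_def field_simps)
    finally show ?case .
  qed
  have "det2 (P * Mat2 p q 0 s * adj2 P) = 1" using B lift_det by blast
  then have ps: "p * s = 1" using P by simp
  have "range f \<subseteq> {M. det2 M = 1 \<and> mob (P * M * adj2 P) \<in> \<Gamma> \<and>
    (\<exists>a b c d. M = Mat2 a b c d \<and> a\<^sup>2 + b\<^sup>2 + c\<^sup>2 + d\<^sup>2 \<le> p\<^sup>2 + q\<^sup>2 + s\<^sup>2)}"
  proof -
    have "(q / k ^ (2 * n))\<^sup>2 \<le> q\<^sup>2" for n
    proof -
      have "1 \<le> \<bar>k\<bar> ^ (2 * n)" using k by (simp add: one_le_power)
      then have "1 \<le> (\<bar>k\<bar> ^ (2 * n))\<^sup>2" by (rule one_le_power)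
      then have "1 \<le> (k ^ (2 * n))\<^sup>2" by (simp only: power_even_abs dvd_triv_left)
      then show ?thesis by (simp add: power_divide divide_le_eq mult_le_cancel_left1 k0 zero_less_power2)
    qed
    then show ?thesis using f ps by (force simp: f_def lift_def)
  qed
  then have "finite (range f)" using finite_conj_bounded[OF P] finite_subset by blast
  moreover have "inj f"
  proof (rule injI)
    fix m n assume "f m = f n"
    then have "k ^ (2 * m) = k ^ (2 * n)" using q k0 by (simp add: f_def field_simps)
    then have "\<bar>k\<bar> ^ (2 * m) = \<bar>k\<bar> ^ (2 * n)" by (metis power_abs)
    then show "m = n" using k by (simp add: power_inject_exp)
  qed
  ultimately show False using finite_imageD by blast
qed

text \<open>If two elements share exactly one fixed point on the boundary circle, conjugating one by powers
  of the other gives infinitely many elements in a bounded region.\<close>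

lemma shared_fixed_point:
  assumes P: "det2 P = 1" and k: "\<bar>k\<bar> > 1" and A: "P * diag2 k * adj2 P \<in> lift"
    and B: "P * Mat2 p q r s * adj2 P \<in> lift" and qr: "q * r = 0"
  shows "q = 0 \<and> r = 0"
proof (cases "r = 0")
  case True
  then show ?thesis using shared_fixed_point_aux[OF P k A] B by blast
next
  case False
  then have q: "q = 0" using qr by simp
  \<comment> \<open>The half-turn exchanges 0 and infinity and makes the triangular matrix upper
    triangular. The first element is replaced by its inverse, so the same \<open>k\<close>
    serves.\<close>
  define J where "J = Mat2 0 (-1) 1 0"
  have PJ: "det2 (P * J) = 1" using P by (simp add: J_def)
  have k0: "k \<noteq> 0" using k by auto
  have "adj2 (P * diag2 k * adj2 P) = P * J * diag2 k * adj2 (P * J)"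
    by (simp add: mult.assoc) (simp add: J_def diag2_def flip: mult.assoc[of J] mult.assoc[of _ _ "adj2 P"])
  then have "P * J * diag2 k * adj2 (P * J) \<in> lift" using lift_adj2[OF A] by simp
  moreover have "P * Mat2 p q r s * adj2 P = P * J * Mat2 s (- r) 0 p * adj2 (P * J)"
    by (simp add: mult.assoc) (simp add: q J_def flip: mult.assoc[of J] mult.assoc[of _ _ "adj2 P"])
  ultimately have "- r = 0" using shared_fixed_point_aux[OF PJ k, of s "- r" p] B by simp
  then show ?thesis using q by simp
qed

text \<open>With \<open>A' = B A B\<inverse>\<close> and \<open>x = tr A\<close>, absence of elliptic elements is applied to \<open>A A'\<close> and
  \<open>[A, A']\<close>; the borderline case \<open>x\<^sup>2 = tr [A,B] + 2\<close> is the one where \<open>A\<close> and \<open>A'\<close> share a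
  fixed point.\<close>

lemma trace_lower_bound:
  assumes A: "A \<in> lift" and B: "B \<in> lift"
    and \<kappa>: "2 < tr2 (comm2 A B)" "tr2 (comm2 A B) < 3"
  shows "\<bar>tr2 A\<bar> > 3"
proof -
  define t where "t = tr2 (comm2 A B)"
  define x where "x = (tr2 A)\<^sup>2"
  define A' where "A' = B * A * adj2 B"
  have dA: "det2 A = 1" and dB: "det2 B = 1" using A B lift_det by auto
  have A': "A' \<in> lift" unfolding A'_def using A B lift_mult lift_adj2 by blast
  have id: "tr2 (A * A') = x - t" "tr2 (comm2 A A') = 2 + (t - 2) * (t + 2 - x)"
    using tr2_comm2_conj_self[OF dA dB] by (simp_all add: A'_def t_def x_def)
  have t: "2 < t" "t < 3" using \<kappa> by (simp_all add: t_def)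
  have x4: "x \<ge> 4" using power_mono[OF lift_not_elliptic[OF A], of 2] by (simp add: x_def)
  \<comment> \<open>The alternative \<open>x - t <= -2\<close> is impossible, as
    \<open>x >= 4\<close> and \<open>t < 3\<close>.\<close>
  have "x - t \<ge> 2" using lift_not_elliptic[OF lift_mult[OF A A']] id(1) x4 t by simp
  then consider "x = t + 2" | "x > t + 2" by linarith
  then show ?thesis
  proof cases
    case 1
    have "\<not> \<bar>tr2 A\<bar> \<le> 2" using power_mono[of "\<bar>tr2 A\<bar>" 2 2] 1 t by (auto simp: x_def)
    then obtain P k where P: "det2 P = 1" "\<bar>k\<bar> > 1" "A = P * diag2 k * adj2 P"
      using diagonalize2[OF dA] by (metis not_le)
    define N where "N = adj2 P * B * P"
    obtain p q r s where N: "N = Mat2 p q r s" by (cases N)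
    have BN: "B = P * N * adj2 P"
      by (simp add: N_def mult.assoc adj2_cancel[OF P(1)] adj2_inverse[OF P(1)])
    have "det2 N = 1" using dB P(1) by (simp add: N_def)
    then have det: "p * s - q * r = 1" using N by simp
    have k0: "k \<noteq> 0" using P(2) by auto
    define M where "M = N * diag2 k * adj2 N"
    have A'M: "A' = P * M * adj2 P"
      by (simp add: A'_def M_def BN P(3) mult.assoc adj2_cancel[OF P(1)])
    obtain a b c d where Me: "M = Mat2 a b c d" by (cases M)
    have bc: "b = - p * q * (k - 1/k)" "c = r * s * (k - 1/k)"
      using Me unfolding M_def N diag2_def by (auto simp: algebra_simps)
    have kk: "k - 1/k \<noteq> 0"
      using P(2) k0 by (auto simp: field_simps) (metis abs_square_eq_1 less_irrefl power2_eq_square)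
    have "det2 M = 1" using \<open>det2 N = 1\<close> k0 by (simp add: M_def)
    then have "tr2 (comm2 A A') = 2 - b * c * (k - 1/k)\<^sup>2"
      unfolding A'M P(3) comm2_conj[OF P(1)] tr2_conj[OF P(1)] Me
      by (intro tr2_comm2_diag2[OF k0]) simp
    then have "b * c = 0" using 1 id(2) kk by simp
    moreover have "P * diag2 k * adj2 P \<in> lift" using A P(3) by simp
    moreover have "P * Mat2 a b c d * adj2 P \<in> lift" using A' A'M Me by simp
    ultimately have "b = 0 \<and> c = 0" using shared_fixed_point[OF P(1,2)] by blast
    \<comment> \<open>\<open>A'\<close> fixes both ends of the axis of \<open>A\<close>, so
      \<open>B\<close> preserves this pair. Fixing each end gives commutator trace 2; exchanging
      them gives \<open>tr2 B = 0\<close>, an elliptic element.\<close>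
    then have z: "p * q = 0" "r * s = 0" using bc kk by auto
    then consider "q = 0 \<and> r = 0" | "p = 0 \<and> s = 0" using det by force
    then show ?thesis
    proof cases
      case 1
      have "t = 2 - q * r * (k - 1/k)\<^sup>2"
        unfolding t_def P(3) BN comm2_conj[OF P(1)] tr2_conj[OF P(1)] N
        by (rule tr2_comm2_diag2[OF k0 det])
      then show ?thesis using 1 t by simp
    next
      case 2
      then have "tr2 B = 0" unfolding BN tr2_conj[OF P(1)] N by simp
      then show ?thesis using lift_not_elliptic[OF B] by simp
    qed
  next
    case 2
    have "comm2 A A' \<in> lift" unfolding comm2_def using A A' lift_mult lift_adj2 by blast
    then have "\<bar>2 + (t - 2) * (t + 2 - x)\<bar> \<ge> 2" using lift_not_elliptic id(2) by metis
    moreover have "(t - 2) * (t + 2 - x) < 0" using 2 t by (simp add: mult_pos_neg)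
    \<comment> \<open>A trace below 2 must be at most -2, hence the 4. For \<open>x <= 9\<close> the
      left side is at most \<open>(t - 2) * (7 - t)\<close>, which reaches 4 only at
      \<open>t = 3\<close>; this is where the bound 3 on the trace of \<open>A\<close> comes
      from.\<close>
    ultimately have "(t - 2) * (x - t - 2) \<ge> 4" by (simp add: algebra_simps)
    moreover have "(t - 2) * (x - t - 2) < 1 * (x - t - 2)"
      using 2 t by (intro mult_strict_right_mono) auto
    moreover have "(t - 2) * (x - t - 2) \<le> (t - 2) * (9 - t - 2)" if "x \<le> 9"
      using that t by (intro mult_left_mono) auto
    moreover have "(t - 2) * (9 - t - 2) < 4"
    proof -
      have "4 - (t - 2) * (9 - t - 2) = (t - 3) * (t - 6)" by (simp add: algebra_simps)
      moreover have "(t - 3) * (t - 6) > 0" using t by (simp add: mult_neg_neg)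
      ultimately show ?thesis by linarith
    qed
    ultimately have "x > 9" by linarith
    then show ?thesis using power_mono[of "\<bar>tr2 A\<bar>" 3 2] by (force simp: x_def)
  qed
qed

end

subsection \<open>Traces of commutators\<close>

text \<open>Here \<open>u\<close> is the smaller of two numbers with sum \<open>X * Y\<close>. If it
  exceeded \<open>X - 1\<close>, their product would be at least
  \<open>(X - 1) * (X * Y - X + 1)\<close>, which is at least \<open>X^2 + Y^2 - 4\<close> for
  \<open>X >= Y >= 3\<close>. Equality holds at \<open>X = Y = 3\<close>.\<close>

lemma descent_inequality:
  fixes X Y u :: real
  assumes "X \<ge> Y" "Y \<ge> 3" "2 * u \<le> X * Y" "u * (X * Y - u) < X\<^sup>2 + Y\<^sup>2 - 4"
  shows "u \<le> X - 1"
proof (rule ccontr)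
  assume "\<not> u \<le> X - 1"
  then have u: "u - X + 1 > 0" by simp
  have "X * Y \<ge> X * 3" using assms by (intro mult_left_mono) auto
  then have "X * Y - u - X + 1 \<ge> 0" using assms by linarith
  then have "(u - X + 1) * (X * Y - u - X + 1) \<ge> 0" using u by simp
  then have "u * (X * Y - u) \<ge> (X - 1) * (X * Y - X + 1)" by (simp add: algebra_simps)
  then have "Y\<^sup>2 + Y * (X - X\<^sup>2) + 2 * X\<^sup>2 - 2 * X - 3 > 0"
    using assms(4) by (simp add: algebra_simps power2_eq_square)
  also have "Y\<^sup>2 + Y * (X - X\<^sup>2) + 2 * X\<^sup>2 - 2 * X - 3
      = - ((X - 3) * (X + 2)) - (Y - 3) * ((X - 3) * (X + 1) + (X - Y))"
    by (simp add: algebra_simps power2_eq_square)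
  also have "\<dots> \<le> 0"
    using assms by (smt (verit) mult_nonneg_nonneg)
  finally show False by simp
qed

context surface_group
begin

text \<open>The traces of \<open>A B\<close> and \<open>A B^-1\<close> have sum
  \<open>tr2 A * tr2 B\<close> and, by Fricke's identity, a product fixed by the commutator trace.
  The one of smaller absolute value provides \<open>C\<close>.\<close>

lemma descent_step:
  assumes A: "A \<in> lift" and B: "B \<in> lift" and le: "\<bar>tr2 B\<bar> \<le> \<bar>tr2 A\<bar>"
    and \<kappa>: "2 < tr2 (comm2 A B)" "tr2 (comm2 A B) < 3"
  obtains C where "C \<in> lift" "tr2 (comm2 C B) = tr2 (comm2 A B)" "\<bar>tr2 C\<bar> \<le> \<bar>tr2 A\<bar> - 1"
proof -
  have dA: "det2 A = 1" and dB: "det2 B = 1" using A B lift_det by auto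
  define X Y where "X = \<bar>tr2 A\<bar>" and "Y = \<bar>tr2 B\<bar>"
  define v w where "v = tr2 (A * B)" and "w = tr2 (A * adj2 B)"
  have XY: "X \<ge> Y" "Y \<ge> 3"
    using le trace_lower_bound[OF B A] \<kappa> by (auto simp: X_def Y_def tr2_comm2_commute[OF dB dA])
  have sum: "v + w = tr2 A * tr2 B" by (simp add: v_def w_def tr2_mult_adj2)
  have prod: "v * w = X\<^sup>2 + Y\<^sup>2 - 2 - tr2 (comm2 A B)"
    unfolding fricke[OF dA dB] X_def Y_def v_def w_def tr2_mult_adj2
    by (simp add: algebra_simps power2_eq_square)
  have "X\<^sup>2 \<ge> 9" "Y\<^sup>2 \<ge> 9" using XY power_mono[of 3 X 2] power_mono[of 3 Y 2] by auto
  \<comment> \<open>Equal signs of \<open>v\<close> and \<open>w\<close> make their absolute values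
    add up to \<open>X * Y\<close>.\<close>
  then have pos: "v * w > 0" using prod \<kappa> by linarith
  then have abs_sum: "\<bar>v\<bar> + \<bar>w\<bar> = X * Y"
    using sum by (auto simp: X_def Y_def zero_less_mult_iff simp flip: abs_mult)
  have abs_prod: "\<bar>v\<bar> * \<bar>w\<bar> < X\<^sup>2 + Y\<^sup>2 - 4"
    using pos prod \<kappa> by (simp flip: abs_mult)
  show ?thesis
  proof (cases "\<bar>v\<bar> \<le> \<bar>w\<bar>")
    case True
    have eq: "X * Y - \<bar>v\<bar> = \<bar>w\<bar>" using abs_sum by simp
    have "2 * \<bar>v\<bar> \<le> X * Y" using True abs_sum by linarith
    then have "\<bar>v\<bar> \<le> X - 1"
      by (rule descent_inequality[OF XY]) (unfold eq, rule abs_prod)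
    then show ?thesis
      using that[of "A * B"] A B lift_mult tr2_comm2_mult[OF dA dB] by (simp add: v_def X_def)
  next
    case False
    have eq: "X * Y - \<bar>w\<bar> = \<bar>v\<bar>" using abs_sum by simp
    have "2 * \<bar>w\<bar> \<le> X * Y" using False abs_sum by linarith
    then have "\<bar>w\<bar> \<le> X - 1"
      by (rule descent_inequality[OF XY]) (unfold eq, subst mult.commute, rule abs_prod)
    moreover have "tr2 (comm2 (A * adj2 B) B) = tr2 (comm2 A B)"
      using tr2_comm2_mult[of A "adj2 B"] tr2_comm2_adj2[of "A * adj2 B" B] tr2_comm2_adj2[OF dA dB] dA dB
      by simp
    ultimately show ?thesis
      using that[of "A * adj2 B"] A B lift_mult lift_adj2 by (simp add: w_def X_def)
  qed
qed

text \<open>Fricke descent, where the commutator trace is invariant and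
  \<open>\<bar>tr A\<bar> + \<bar>tr B\<bar>\<close> drops by at least \<open>1\<close> in each step.\<close>

lemma commutator_trace_gap:
  assumes "A \<in> lift" "B \<in> lift" "2 < tr2 (comm2 A B)"
  shows "3 \<le> tr2 (comm2 A B)"
proof (rule ccontr)
  assume "\<not> ?thesis"
  then have less: "tr2 (comm2 A B) < 3" by simp
  \<comment> \<open>Infinite descent, phrased as induction on an integer bound \<open>n\<close> for
    the sum of absolute traces.\<close>
  have "\<not> \<bar>tr2 A\<bar> + \<bar>tr2 B\<bar> < real n"
    if "A \<in> lift" "B \<in> lift" "2 < tr2 (comm2 A B)" "tr2 (comm2 A B) < 3" for n A B
    using that
  proof (induction n arbitrary: A B)
    case 0
    then show ?case by simp
  next
    case (Suc n)
    have det: "det2 A = 1" "det2 B = 1" using Suc.prems lift_det by auto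
    show ?case
    proof (cases "\<bar>tr2 B\<bar> \<le> \<bar>tr2 A\<bar>")
      case True
      obtain C where C: "C \<in> lift" "tr2 (comm2 C B) = tr2 (comm2 A B)" "\<bar>tr2 C\<bar> \<le> \<bar>tr2 A\<bar> - 1"
        using descent_step[OF Suc.prems(1,2) True Suc.prems(3,4)] by blast
      then have "\<not> \<bar>tr2 C\<bar> + \<bar>tr2 B\<bar> < real n" using Suc by metis
      then show ?thesis using C(3) by simp
    next
      case False
      have eq: "tr2 (comm2 B A) = tr2 (comm2 A B)" using tr2_comm2_commute det by blast
      obtain C where C: "C \<in> lift" "tr2 (comm2 C A) = tr2 (comm2 B A)" "\<bar>tr2 C\<bar> \<le> \<bar>tr2 B\<bar> - 1"
        using descent_step[OF Suc.prems(2,1)] False Suc.prems(3,4) eq by auto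
      then have "\<not> \<bar>tr2 C\<bar> + \<bar>tr2 A\<bar> < real n" using Suc eq by metis
      then show ?thesis using C(3) by simp
    qed
  qed
  then show False using assms less reals_Archimedean2 by blast
qed

subsection \<open>Translations along lifts of closed geodesics\<close>

text \<open>Finitely many group elements occur for \<open>t \<in> {0..1}\<close>, so one of them works for two values of \<open>t\<close>,
  hence for the whole line.\<close>

lemma translation_along_lift:
  assumes cg: "closed_geodesic \<Gamma> \<gamma> L" and c: "unit_speed_line c"
    and above: "\<And>t. surface_proj \<Gamma> (c t) = \<gamma> t"
  obtains g where "g \<in> \<Gamma>" "\<And>t. g (c t) = c (t + L)"
proof -
  have L: "L > 0" "\<And>t. \<gamma> (t + L) = \<gamma> t" using cg by (auto simp: closed_geodesic_def)
  have "\<exists>g\<in>\<Gamma>. g (c t) = c (t + L)" for t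
  proof -
    have "c (t + L) \<in> surface_proj \<Gamma> (c (t + L))"
      unfolding surface_proj_def using id_in by (auto intro!: image_eqI[of _ _ id])
    then have "c (t + L) \<in> surface_proj \<Gamma> (c t)" by (simp add: above L(2))
    then show ?thesis by (auto simp: surface_proj_def)
  qed
  then obtain g where g: "\<And>t. g t \<in> \<Gamma>" "\<And>t. g t (c t) = c (t + L)" by metis
  have dist_c: "dist (c s) (c t) = \<bar>s - t\<bar>" for s t
    using c by (simp add: unit_speed_line_def dist_real_def)
  have "dist (g t (c 0)) (c 0) \<le> 2 + L" if "t \<in> {0..1}" for t
  proof -
    have "dist (g t (c 0)) (c (t + L)) = \<bar>t\<bar>"
      using isometry[OF g(1), of t "c 0" "c t"] by (simp add: g(2) dist_c)
    then show ?thesis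
      using dist_triangle[of "g t (c 0)" "c 0" "c (t + L)"] dist_c[of "t + L" 0] that L(1) by simp
  qed
  then have "g ` {0..1} \<subseteq> {h \<in> \<Gamma>. dist (h (c 0)) (c 0) \<le> 2 + L}" using g(1) by auto
  then have "finite (g ` {0..1::real})" using properly_discontinuous finite_subset by blast
  then have "\<not> inj_on g {0..1::real}" using finite_imageD[of g "{0..1}"] infinite_Icc[of 0 "1::real"] by auto
  then obtain s t where st: "s \<noteq> t" "g s = g t" by (auto simp: inj_on_def)
  have u1: "unit_speed_line (\<lambda>r. g s (c r))" and u2: "unit_speed_line (\<lambda>r. c (r + L))"
    using isometry[OF g(1)] by (auto simp: unit_speed_line_def dist_c dist_real_def)
  have "g s (c r) = c (r + L)" for r
    using unit_speed_line_eq[OF u1 u2 st(1), of r] g(2)[of s] g(2)[of t] st(2) by simp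
  then show ?thesis using that g(1) by blast
qed

text \<open>Undoing the Moebius translation of the same length leaves an isometry fixing the axis
  pointwise. If that were the reflection, \<open>g\<close> would be a glide reflection, which
  orientability excludes.\<close>

lemma translation_in_lift:
  assumes P: "det2 P = 1" and g: "g \<in> \<Gamma>"
    and transl: "\<And>t. g (mob P (iaxis t)) = mob P (iaxis (t + L))"
  shows "P * diag2 (exp (L / 2)) * adj2 P \<in> lift"
proof -
  define D where "D = diag2 (exp (L / 2))"
  have D: "det2 D = 1" by (simp add: D_def)
  have PD: "det2 (P * D) = 1" using P D by simp
  define f where "f z = mob (adj2 (P * D)) (g (mob P z))" for z
  have "f = id \<or> f = refl_hyp"
  proof (rule isometry_fixing_iaxis)
    show "dist (f z) (f w) = dist z w" for z w
      using P D unfolding f_def by (simp add: mob_isometry isometry[OF g] del: adj2_mult)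
    show "f (iaxis t) = iaxis t" for t
      using mob_adj2(1)[OF PD, of "iaxis t"] P D
      by (simp add: f_def transl mob_mult D_def mob_diag2_iaxis)
  qed
  have geq: "g z = mob (P * D) (f (mob (adj2 P) z))" for z
    unfolding f_def by (simp only: mob_adj2[OF PD] mob_adj2[OF P])
  from \<open>f = id \<or> f = refl_hyp\<close> show ?thesis
  proof
    assume "f = id"
    then have "g = mob (P * D * adj2 P)" using P D by (auto simp: geq mob_mult)
    then show ?thesis using P D g by (simp add: lift_def D_def)
  next
    assume f: "f = refl_hyp"
    obtain a b c d where Pe: "adj2 P = Mat2 a b c d" by (cases "adj2 P")
    have det: "a * d - b * c = 1" using P Pe by (metis det2.simps det2_adj2)
    have "g = mob (P * D * Mat2 a (- b) (- c) d) \<circ> refl_hyp"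
      using det P D by (auto simp: geq f Pe refl_hyp_mob mob_mult)
    then show ?thesis using not_orientation_reversing[OF g, of "P * D * Mat2 a (- b) (- c) d"] P D det by simp
  qed
qed

end

lemma unit_speed_line_reparametrize:
  assumes c: "unit_speed_line c" and c': "unit_speed_line c'" and "range c = range c'"
  obtains \<sigma> \<tau> where "\<sigma> = 1 \<or> \<sigma> = - 1" "\<And>t. c' t = c (\<sigma> * t + \<tau>)"
proof -
  have "\<exists>s. c' t = c s" for t using assms(3) by (metis rangeE rangeI)
  then obtain \<phi> where \<phi>: "\<And>t. c' t = c (\<phi> t)" by metis
  have "\<bar>\<phi> 1 - \<phi> 0\<bar> = 1"
    using c c' \<phi> unfolding unit_speed_line_def dist_real_def by (metis abs_one diff_zero)
  then have \<sigma>: "\<phi> 1 - \<phi> 0 = 1 \<or> \<phi> 1 - \<phi> 0 = -1" by linarith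
  have u: "unit_speed_line (\<lambda>t. c ((\<phi> 1 - \<phi> 0) * t + \<phi> 0))"
    using c \<sigma> by (auto simp: unit_speed_line_def dist_real_def)
  have "c' t = c ((\<phi> 1 - \<phi> 0) * t + \<phi> 0)" for t
    by (rule unit_speed_line_eq[OF c' u zero_neq_one]) (simp_all add: \<phi>)
  then show ?thesis using that \<sigma> by blast
qed

text \<open>The parametrisation in \<open>length_on_line\<close> is an arbitrary choice, so
  \<open>c'\<close> need not be the lift of the closed geodesic. If it runs backwards, the inverse
  translation is taken.\<close>

lemma (in surface_group) geodesic_above_lift:
  assumes cg: "closed_geodesic \<Gamma> \<gamma> L" and ab: "geodesic_above \<Gamma> \<gamma> l"
    and c': "unit_speed_line c'" "range c' = l"
  obtains P where "det2 P = 1" "\<And>t. c' t = mob P (iaxis t)"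
    "P * diag2 (exp (L / 2)) * adj2 P \<in> lift"
proof -
  obtain c where c: "unit_speed_line c" "l = range c" "\<And>t. surface_proj \<Gamma> (c t) = \<gamma> t"
    using ab unfolding geodesic_above_def by blast
  obtain g where g: "g \<in> \<Gamma>" "\<And>t. g (c t) = c (t + L)"
    using translation_along_lift[OF cg c(1,3)] by blast
  obtain \<sigma> \<tau> where \<sigma>: "\<sigma> = 1 \<or> \<sigma> = - 1" "\<And>t. c' t = c (\<sigma> * t + \<tau>)"
    using unit_speed_line_reparametrize[OF c(1) c'(1)] c'(2) c(2) by blast
  have "\<exists>h\<in>\<Gamma>. \<forall>t. h (c' t) = c' (t + L)"
    using \<sigma>(1)
  proof
    assume "\<sigma> = 1"
    then have "\<forall>t. g (c' t) = c' (t + L)" by (simp add: \<sigma>(2) g(2) add_ac)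
    then show ?thesis using g(1) by blast
  next
    assume s: "\<sigma> = - 1"
    obtain h where h: "h \<in> \<Gamma>" "h \<circ> g = id" using inverse_in[OF g(1)] by blast
    have "h (c' t) = c' (t + L)" for t
    proof -
      have "c' t = g (c' (t + L))" by (simp add: s \<sigma>(2) g(2))
      then show ?thesis using fun_cong[OF h(2), of "c' (t + L)"] by simp
    qed
    then show ?thesis using h(1) by blast
  qed
  then obtain h where h: "h \<in> \<Gamma>" "\<And>t. h (c' t) = c' (t + L)" by blast
  obtain P where P: "det2 P = 1" "\<And>t. c' t = mob P (iaxis t)"
    using unit_speed_line_normal_form[OF c'(1)] by blast
  have "P * diag2 (exp (L / 2)) * adj2 P \<in> lift"
    using translation_in_lift[OF P(1) h(1)] h(2) P(2) by simp
  then show ?thesis using that P by blast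
qed

subsection \<open>Length of the projection\<close>

text \<open>Circles centred at 0 meet the imaginary half-line at right angles, so the nearest point
  to \<open>w\<close> has height \<open>|w|\<close>.\<close>

lemma orth_projection_mob_iaxis:
  assumes P: "det2 P = 1" and m: "m = range (\<lambda>t. mob P (iaxis t))"
    and t: "mob P (iaxis t) \<in> orth_projection m A"
  obtains z where "z \<in> A" "exp (2 * t) = (cmod (Rep_hyp (mob (adj2 P) z)))\<^sup>2"
proof -
  obtain z where z: "z \<in> A" "dist z (mob P (iaxis t)) = infdist z m"
    using t by (auto simp: orth_projection_def)
  define w where "w = mob (adj2 P) z"
  define y where "y = Im (Rep_hyp w)"
  have y: "y > 0" by (simp add: y_def)
  have dw: "dist z (mob P (iaxis s)) = dist w (iaxis s)" for s
    using mob_isometry[OF P, of w "iaxis s"] by (simp add: w_def mob_adj2[OF P])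
  have "dist w (iaxis t) \<le> dist w (iaxis s)" for s
    using infdist_le[of "mob P (iaxis s)" m z] z(2) m by (simp add: dw)
  then have le: "cosh (dist w (iaxis t)) \<le> cosh (dist w (iaxis s))" for s
    by (simp add: cosh_real_nonneg_le_iff)
  define S where "S = cmod (Rep_hyp w)"
  define T where "T = exp t"
  have "Rep_hyp w \<noteq> 0" using Im_Rep_hyp_nonzero[of w] by (metis zero_complex.sel(2))
  then have S: "S > 0" by (simp add: S_def)
  have T: "T > 0" by (simp add: T_def)
  \<comment> \<open>Comparison with the point of height \<open>|w|\<close> alone suffices: it yields
    \<open>S * (S - T)^2 <= 0\<close>.\<close>
  have "(S\<^sup>2 + T\<^sup>2) / (2 * y * T) \<le> (S\<^sup>2 + S\<^sup>2) / (2 * y * S)"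
    using le[of "ln S"] S unfolding cosh_dist_iaxis exp_double S_def[symmetric] T_def[symmetric] y_def[symmetric]
    by simp
  then have "(S\<^sup>2 + T\<^sup>2) * S \<le> 2 * S\<^sup>2 * T"
    using S T y by (simp add: divide_simps split: if_splits)
  then have "S * (S - T)\<^sup>2 \<le> 0" by (simp add: algebra_simps power2_eq_square)
  then have "S = T" using S by (simp add: mult_le_0_iff)
  then have "exp (2 * t) = (cmod (Rep_hyp (mob (adj2 P) z)))\<^sup>2"
    by (simp add: S_def T_def w_def exp_double)
  then show ?thesis using that z(1) by blast
qed

lemma cmod_mob_iaxis:
  assumes "a * d - b * c = 1"
  shows "(cmod (Rep_hyp (mob (Mat2 a b c d) (iaxis u))))\<^sup>2
    = (a\<^sup>2 * exp (2 * u) + b\<^sup>2) / (c\<^sup>2 * exp (2 * u) + d\<^sup>2)"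
  using assms by (simp add: Rep_mob norm_divide power_divide cmod_power2 exp_double power_mult_distrib add.commute)

section \<open>From the commutator trace to the length bound\<close>

lemma sinh_cosh_bound:
  fixes a b :: real
  assumes "a > 0" "b > 0"
  shows "sinh a * sinh b < cosh (a + b)" "2 * sinh a * sinh b < sinh (a + b)"
proof -
  have s: "sinh a > 0" "sinh b > 0" using assms by simp_all
  have c: "sinh a < cosh a" "sinh b < cosh b" by (simp_all add: sinh_less_cosh_real)
  show "sinh a * sinh b < cosh (a + b)"
    using mult_pos_pos[OF cosh_real_pos[of a] cosh_real_pos[of b]] by (simp add: cosh_add)
  have "sinh a * sinh b < sinh a * cosh b" "sinh a * sinh b < cosh a * sinh b"
    using s c by auto
  then show "2 * sinh a * sinh b < sinh (a + b)" by (simp add: sinh_add)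
qed

text \<open>\<open>16 w (1 + w) sinh\<^sup>2 (a/2) sinh\<^sup>2 (b/2)\<close> is the commutator trace minus \<open>2\<close>.\<close>

lemma cross_ratio_bound:
  fixes a b w :: real
  assumes ab: "a > 0" "b > 0" and w: "w \<noteq> 0" "w \<noteq> -1"
    and K: "16 * (w * (1 + w)) * (sinh (a/2))\<^sup>2 * (sinh (b/2))\<^sup>2 \<le> -4 \<or>
      16 * (w * (1 + w)) * (sinh (a/2))\<^sup>2 * (sinh (b/2))\<^sup>2 \<ge> 1"
  shows "\<bar>ln \<bar>(1 + w) / w\<bar>\<bar> < a + b"
proof -
  define r where "r = \<bar>(1 + w) / w\<bar>"
  define X where "X = \<bar>ln r\<bar>"
  define p where "p = w * (1 + w)"
  define s where "s = sinh (a/2) * sinh (b/2)"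
  have s: "s > 0" using ab by (simp add: s_def)
  have w1: "1 + w \<noteq> 0" using w by auto
  have r: "r > 0" using w by (auto simp: r_def)
  have "cosh X = cosh (ln r)" by (simp add: X_def)
  then have X: "2 * cosh X = r + 1 / r"
    using r by (simp add: cosh_def exp_minus inverse_eq_divide)
  have half: "cosh X = 2 * (cosh (X/2))\<^sup>2 - 1" "cosh X = 2 * (sinh (X/2))\<^sup>2 + 1"
    using cosh_double[of "X/2"] cosh_square_eq[of "X/2"] by simp_all
  have X0: "X \<ge> 0" by (simp add: X_def)
  have K': "16 * p * s\<^sup>2 \<le> -4 \<or> 16 * p * s\<^sup>2 \<ge> 1"
    using K by (simp add: p_def s_def power_mult_distrib algebra_simps)
  have "X / 2 < (a + b) / 2"
    using K'
  proof
    assume K: "16 * p * s\<^sup>2 \<le> -4"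
    then have p: "p < 0"
    proof (rule contrapos_pp)
      assume "\<not> p < 0"
      then have "p * s\<^sup>2 \<ge> 0" by simp
      then show "\<not> 16 * p * s\<^sup>2 \<le> - 4" by linarith
    qed
    then have neg: "(1 + w) / w < 0" unfolding p_def by (auto simp: mult_less_0_iff divide_less_0_iff)
    then have "r = - ((1 + w) / w)" unfolding r_def by (rule abs_of_neg)
    then have "r * p = -(1 + w)\<^sup>2" "1 / r * p = -w\<^sup>2"
      using w w1 by (simp_all add: p_def power2_eq_square)
    \<comment> \<open>This says that \<open>p * cosh^2 (X/2)\<close> is -1/4, while \<open>K\<close>
      says \<open>p * s^2 <= -1/4\<close>. Nothing is lost in the crossing case.\<close>
    then have "(r + 1 / r + 2) * p = -1"
      by (simp add: p_def ring_distribs power2_eq_square)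
    moreover have "r + 1 / r + 2 = 4 * (cosh (X/2))\<^sup>2" using X half(1) by linarith
    ultimately have "4 * (cosh (X/2))\<^sup>2 * p = -1" by simp
    then have "p * s\<^sup>2 \<le> p * (cosh (X/2))\<^sup>2" using K by (simp add: mult.commute)
    then have "(cosh (X/2))\<^sup>2 \<le> s\<^sup>2" using p by simp
    then have "cosh (X/2) \<le> s" by (rule power2_le_imp_le) (use s in simp)
    also have "s < cosh (a/2 + b/2)" unfolding s_def using sinh_cosh_bound(1)[of "a/2" "b/2"] ab by simp
    finally have "X / 2 < a/2 + b/2"
      using cosh_real_nonneg_less_iff[of "X/2" "a/2 + b/2"] X0 ab by simp
    then show ?thesis by simp
  next
    assume K: "16 * p * s\<^sup>2 \<ge> 1"
    then have p: "p > 0"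
    proof (rule contrapos_pp)
      assume "\<not> p > 0"
      then have "p * s\<^sup>2 \<le> 0" by (simp add: mult_nonpos_nonneg)
      then show "\<not> 16 * p * s\<^sup>2 \<ge> 1" by linarith
    qed
    then have pos: "(1 + w) / w > 0" unfolding p_def by (auto simp: zero_less_mult_iff zero_less_divide_iff)
    then have "r = (1 + w) / w" unfolding r_def by (rule abs_of_pos)
    then have "r * p = (1 + w)\<^sup>2" "1 / r * p = w\<^sup>2"
      using w w1 by (simp_all add: p_def power2_eq_square)
    then have "(r + 1 / r - 2) * p = 1"
      by (simp add: p_def ring_distribs power2_eq_square)
    moreover have "r + 1 / r - 2 = 4 * (sinh (X/2))\<^sup>2" using X half(2) by linarith
    ultimately have "4 * (sinh (X/2))\<^sup>2 * p = 1" by simp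
    \<comment> \<open>Here \<open>p * sinh^2 (X/2)\<close> is 1/4, while \<open>K\<close> gives only
      \<open>p * s^2 >= 1/16\<close>. The lost factor 4 becomes the 2 in front of
      \<open>s\<close>.\<close>
    then have "4 * (p * (sinh (X/2))\<^sup>2) = 1" by (simp only: mult_ac)
    moreover have "16 * (p * s\<^sup>2) \<ge> 1" using K by (simp only: mult_ac)
    ultimately have "p * (sinh (X/2))\<^sup>2 \<le> 4 * (p * s\<^sup>2)" by linarith
    also have "\<dots> = p * (2 * s)\<^sup>2" by (simp add: power_mult_distrib)
    finally have "p * (sinh (X/2))\<^sup>2 \<le> p * (2 * s)\<^sup>2" .
    then have "(sinh (X/2))\<^sup>2 \<le> (2 * s)\<^sup>2" using p by simp
    then have "sinh (X/2) \<le> 2 * s" by (rule power2_le_imp_le) (use s in simp)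
    also have "2 * s < sinh (a/2 + b/2)" unfolding s_def using sinh_cosh_bound(2)[of "a/2" "b/2"] ab by simp
    finally have "X / 2 < a/2 + b/2" by (simp only: sinh_real_less_iff)
    then show ?thesis by simp
  qed
  then show ?thesis by (simp add: X_def r_def)
qed

text \<open>The quotient is the average of \<open>q^2 / s^2\<close> and \<open>p^2 / r^2\<close>
  with weights \<open>s^2\<close> and \<open>r^2 * exp (2 * u)\<close>, hence lies between
  them.\<close>

lemma mediant_bounds:
  fixes p q r s t u :: real
  assumes nz: "p \<noteq> 0" "q \<noteq> 0" "r \<noteq> 0" "s \<noteq> 0"
    and t: "exp (2 * t) = (p\<^sup>2 * exp (2 * u) + q\<^sup>2) / (r\<^sup>2 * exp (2 * u) + s\<^sup>2)"
  defines "\<alpha> \<equiv> ln \<bar>q / s\<bar>" and "\<beta> \<equiv> ln \<bar>p / r\<bar>"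
  shows "t \<in> {min \<alpha> \<beta>..max \<alpha> \<beta>}"
proof -
  define v where "v = exp (2 * u)"
  have v: "v > 0" by (simp add: v_def)
  have "r\<^sup>2 * v + s\<^sup>2 > 0" using nz v by (simp add: add_pos_pos)
  then have eq: "(exp t)\<^sup>2 * (r\<^sup>2 * v + s\<^sup>2) = p\<^sup>2 * v + q\<^sup>2"
    using t unfolding v_def[symmetric] exp_double[of t] by (simp add: field_simps)
  have e: "(exp \<alpha>)\<^sup>2 * s\<^sup>2 = q\<^sup>2" "(exp \<beta>)\<^sup>2 * r\<^sup>2 = p\<^sup>2"
    using nz by (simp_all add: \<alpha>_def \<beta>_def power_divide)
  have mono: "(exp x)\<^sup>2 < (exp y)\<^sup>2" if "x < y" for x y :: real
    using that by (simp add: power_strict_mono)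
  have "\<not> (t < \<alpha> \<and> t < \<beta>)"
  proof
    assume h: "t < \<alpha> \<and> t < \<beta>"
    have "(exp t)\<^sup>2 * s\<^sup>2 < q\<^sup>2" "(exp t)\<^sup>2 * r\<^sup>2 < p\<^sup>2"
      unfolding e[symmetric] using h mono nz by auto
    then have "(exp t)\<^sup>2 * r\<^sup>2 * v + (exp t)\<^sup>2 * s\<^sup>2 < p\<^sup>2 * v + q\<^sup>2"
      using v by (intro add_strict_mono mult_strict_right_mono)
    then show False using eq by (simp add: algebra_simps)
  qed
  moreover have "\<not> (\<alpha> < t \<and> \<beta> < t)"
  proof
    assume h: "\<alpha> < t \<and> \<beta> < t"
    have "q\<^sup>2 < (exp t)\<^sup>2 * s\<^sup>2" "p\<^sup>2 < (exp t)\<^sup>2 * r\<^sup>2"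
      unfolding e[symmetric] using h mono nz by auto
    then have "p\<^sup>2 * v + q\<^sup>2 < (exp t)\<^sup>2 * r\<^sup>2 * v + (exp t)\<^sup>2 * s\<^sup>2"
      using v by (intro add_strict_mono mult_strict_right_mono)
    then show False using eq by (simp add: algebra_simps)
  qed
  ultimately show ?thesis by auto
qed

text \<open>The hypotheses leave a diagonal or an antidiagonal matrix: it translates the half-line
  or turns it around.\<close>

lemma mob_range_iaxis:
  assumes det: "p * s - q * r = 1" and z: "p * q = 0" "r * s = 0"
  shows "range (\<lambda>t. mob (Mat2 p q r s) (iaxis t)) = range iaxis"
proof -
  define M where "M = Mat2 p q r s"
  have M: "det2 M = 1" using det by (simp add: M_def)
  have diag: "mob (Mat2 a 0 0 d) (iaxis t) = iaxis (t + 2 * ln \<bar>a\<bar>)" if "a * d = 1" for a d t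
  proof -
    have "a \<noteq> 0" using that by auto
    then have a: "a \<noteq> 0" "d = 1 / a" using that by (simp_all add: eq_divide_eq mult.commute)
    have "exp (2 * ln \<bar>a\<bar>) = a\<^sup>2" using a by (simp add: exp_double)
    then have "Rep_hyp (mob (Mat2 a 0 0 d) (iaxis t)) = Rep_hyp (iaxis (t + 2 * ln \<bar>a\<bar>))"
      using that a by (simp add: Rep_mob complex_eq_iff exp_add power2_eq_square)
    then show ?thesis by (simp only: Rep_hyp_inject)
  qed
  have swap: "mob (Mat2 0 b c 0) (iaxis t) = iaxis (2 * ln \<bar>b\<bar> - t)" if "b * c = - 1" for b c t
  proof -
    have c: "c \<noteq> 0" using that by auto
    have "b \<noteq> 0" using that by auto
    moreover from this have "c = b * c / b" by simp
    ultimately have b: "b \<noteq> 0" "c = - 1 / b" using that by simp_all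
    have "exp (2 * ln \<bar>b\<bar>) = b\<^sup>2" using b by (simp add: exp_double)
    then have "Rep_hyp (mob (Mat2 0 b c 0) (iaxis t)) = Rep_hyp (iaxis (2 * ln \<bar>b\<bar> - t))"
      using that b c by (simp add: Rep_mob complex_eq_iff Re_divide Im_divide exp_diff field_simps power2_eq_square)
    then show ?thesis by (simp only: Rep_hyp_inject)
  qed
  from z det have "(q = 0 \<and> r = 0 \<and> p * s = 1) \<or> (p = 0 \<and> s = 0 \<and> q * r = - 1)" by auto
  then show ?thesis
  proof
    assume h: "q = 0 \<and> r = 0 \<and> p * s = 1"
    have "iaxis t = mob (Mat2 p q r s) (iaxis (t - 2 * ln \<bar>p\<bar>))" for t
      using h diag[of p s] by simp
    then have "iaxis t \<in> range (\<lambda>t. mob (Mat2 p q r s) (iaxis t))" for t by (rule range_eqI)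
    moreover have "mob (Mat2 p q r s) (iaxis t) \<in> range iaxis" for t using h diag[of p s] by simp
    ultimately show ?thesis by (intro equalityI image_subsetI)
  next
    assume h: "p = 0 \<and> s = 0 \<and> q * r = - 1"
    have "iaxis t = mob (Mat2 p q r s) (iaxis (2 * ln \<bar>q\<bar> - t))" for t
      using h swap[of q r] by simp
    then have "iaxis t \<in> range (\<lambda>t. mob (Mat2 p q r s) (iaxis t))" for t by (rule range_eqI)
    moreover have "mob (Mat2 p q r s) (iaxis t) \<in> range iaxis" for t using h swap[of q r] by simp
    ultimately show ?thesis by (intro equalityI image_subsetI)
  qed
qed

lemma exp_half_diff: "exp (x / 2) - 1 / exp (x / 2) = 2 * sinh (x / 2 :: real)"
  by (simp add: sinh_def exp_minus inverse_eq_divide)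

theorem theorem5p4:
  fixes \<Gamma> :: "(hyp \<Rightarrow> hyp) set"
    and \<gamma> \<delta> :: "real \<Rightarrow> hyp set"
    and len_\<gamma> len_\<delta> :: real
    and l m :: "hyp set"
  assumes "hyperbolic_surface_group \<Gamma>"
    and "orientable_surface \<Gamma>"
    and "closed_geodesic \<Gamma> \<gamma> len_\<gamma>"
    and "closed_geodesic \<Gamma> \<delta> len_\<delta>"
    and "geodesic_above \<Gamma> \<gamma> l"
    and "geodesic_above \<Gamma> \<delta> m"
    and "l \<noteq> m"
  shows "length_on_line m (orth_projection m l) < ennreal (len_\<gamma> + len_\<delta>)"
proof -
  interpret surface_group \<Gamma> using assms(1,2) by unfold_locales
  have pos: "len_\<gamma> > 0" "len_\<delta> > 0" using assms(3,4) by (auto simp: closed_geodesic_def)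
  \<comment> \<open>The very choice made in \<open>length_on_line\<close>; all coordinates are
    adapted to it.\<close>
  define c where "c = (SOME c. unit_speed_line c \<and> range c = m)"
  have "\<exists>c. unit_speed_line c \<and> range c = m" using assms(6) by (auto simp: geodesic_above_def)
  then have c: "unit_speed_line c \<and> range c = m" unfolding c_def by (rule someI_ex)
  obtain c' where c': "unit_speed_line c'" "range c' = l" using assms(5) by (auto simp: geodesic_above_def)
  obtain P where P: "det2 P = 1" "\<And>t. c t = mob P (iaxis t)"
      "P * diag2 (exp (len_\<delta> / 2)) * adj2 P \<in> lift"
    using geodesic_above_lift[OF assms(4,6)] c by blast
  obtain Q where Q: "det2 Q = 1" "\<And>t. c' t = mob Q (iaxis t)"
      "Q * diag2 (exp (len_\<gamma> / 2)) * adj2 Q \<in> lift"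
    using geodesic_above_lift[OF assms(3,5) c'] by blast
  obtain p q r s where R: "adj2 P * Q = Mat2 p q r s" by (cases "adj2 P * Q")
  have "det2 (adj2 P * Q) = 1" using P(1) Q(1) by simp
  then have det: "p * s - q * r = 1" unfolding R by simp
  define w where "w = q * r"
  have ps: "p * s = 1 + w" using det by (simp add: w_def)
  define B where "B = P * diag2 (exp (len_\<delta> / 2)) * adj2 P"
  define A where "A = Q * diag2 (exp (len_\<gamma> / 2)) * adj2 Q"
  define N where "N = Mat2 p q r s * diag2 (exp (len_\<gamma> / 2)) * adj2 (Mat2 p q r s)"
  have Qe: "Q = P * Mat2 p q r s" using adj2_cancel(2)[OF P(1), of Q] R by simp
  have AN: "A = P * N * adj2 P" by (simp add: A_def N_def Qe mult.assoc del: adj2.simps)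
  obtain a b e d where Ne: "N = Mat2 a b e d" by (cases N)
  \<comment> \<open>\<open>N\<close> is \<open>A\<close> in coordinates where \<open>B\<close> is
    diagonal, so only its off-diagonal entries enter the commutator trace.\<close>
  have be: "b = - p * q * (2 * sinh (len_\<gamma> / 2))" "e = r * s * (2 * sinh (len_\<gamma> / 2))"
    using Ne unfolding N_def diag2_def by (auto simp: algebra_simps simp flip: exp_half_diff)
  have "det2 N = 1" using det by (simp add: N_def del: adj2.simps)
  then have "tr2 (comm2 B A) = 2 - b * e * (2 * sinh (len_\<delta> / 2))\<^sup>2"
    unfolding B_def AN comm2_conj[OF P(1)] tr2_conj[OF P(1)] Ne exp_half_diff[symmetric]
    by (intro tr2_comm2_diag2) auto
  moreover have "b * e = - (w * (1 + w)) * (2 * sinh (len_\<gamma> / 2))\<^sup>2"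
    unfolding be w_def ps[unfolded w_def, symmetric] by (simp add: power2_eq_square algebra_simps)
  ultimately have \<kappa>: "tr2 (comm2 B A) = 2 + 16 * (w * (1 + w)) * (sinh (len_\<gamma> / 2))\<^sup>2 * (sinh (len_\<delta> / 2))\<^sup>2"
    by (simp add: power_mult_distrib algebra_simps)
  have lift: "A \<in> lift" "B \<in> lift" using P(3) Q(3) by (simp_all add: A_def B_def)
  have sinh_pos: "sinh (len_\<gamma> / 2) > 0" "sinh (len_\<delta> / 2) > 0" using pos by simp_all
  have w: "w \<noteq> 0 \<and> w \<noteq> - 1"
  proof (rule ccontr)
    assume "\<not> ?thesis"
    \<comment> \<open>This product is \<open>p * q * r * s\<close>; it vanishes when an end of
      \<open>l\<close>, at \<open>q / s\<close> or \<open>p / r\<close>, is 0 or infinity.\<close>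
    then have "w * (1 + w) = 0" by auto
    then have "b * e = 0" using \<open>b * e = _\<close> by simp
    moreover have "\<bar>exp (len_\<delta> / 2)\<bar> > 1" using pos by simp
    moreover have "P * Mat2 a b e d * adj2 P \<in> lift" using lift(1) by (simp add: AN Ne)
    ultimately have "b = 0 \<and> e = 0" using shared_fixed_point[OF P(1) _ P(3)] by blast
    then have z: "p * q = 0" "r * s = 0" using be sinh_pos by auto
    have "l = (\<lambda>z. mob P z) ` range (\<lambda>t. mob (Mat2 p q r s) (iaxis t))"
      using c'(2) Q(2) P(1) det by (auto simp: Qe mob_mult image_image)
    also have "\<dots> = m" unfolding mob_range_iaxis[OF det z] using c P(2) by (auto simp: image_image)
    finally show False using assms(7) by simp
  qed
  have nz: "p \<noteq> 0" "q \<noteq> 0" "r \<noteq> 0" "s \<noteq> 0" using w ps by (auto simp: w_def)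
  have "comm2 B A \<in> lift" unfolding comm2_def using lift lift_mult lift_adj2 by blast
  then have "\<bar>tr2 (comm2 B A)\<bar> \<ge> 2" by (rule lift_not_elliptic)
  moreover have "tr2 (comm2 B A) \<noteq> 2" using \<kappa> w sinh_pos by auto
  ultimately have "tr2 (comm2 B A) \<le> - 2 \<or> tr2 (comm2 B A) \<ge> 3"
    using commutator_trace_gap[OF lift(2,1)] by linarith
  then have "16 * (w * (1 + w)) * (sinh (len_\<gamma> / 2))\<^sup>2 * (sinh (len_\<delta> / 2))\<^sup>2 \<le> - 4 \<or>
      16 * (w * (1 + w)) * (sinh (len_\<gamma> / 2))\<^sup>2 * (sinh (len_\<delta> / 2))\<^sup>2 \<ge> 1"
    unfolding \<kappa> by linarith
  then have bound: "\<bar>ln \<bar>(1 + w) / w\<bar>\<bar> < len_\<gamma> + len_\<delta>"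
    using w by (intro cross_ratio_bound pos) auto
  \<comment> \<open>Positions on \<open>m\<close> of the projections of the two ends of
    \<open>l\<close>. Containment of the projection between them is enough for an upper bound on its
    length.\<close>
  define \<alpha> \<beta> where "\<alpha> = ln \<bar>q / s\<bar>" and "\<beta> = ln \<bar>p / r\<bar>"
  have "c -` orth_projection m l \<subseteq> {min \<alpha> \<beta>..max \<alpha> \<beta>}"
  proof
    fix t assume "t \<in> c -` orth_projection m l"
    then have "mob P (iaxis t) \<in> orth_projection m l" by (simp add: P(2))
    moreover have "m = range (\<lambda>t. mob P (iaxis t))" using c P(2) by auto
    ultimately obtain z where z: "z \<in> l" "exp (2 * t) = (cmod (Rep_hyp (mob (adj2 P) z)))\<^sup>2"
      using orth_projection_mob_iaxis[OF P(1)] by blast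
    then obtain u where "z = mob Q (iaxis u)" using c'(2) Q(2) by auto
    then have "mob (adj2 P) z = mob (Mat2 p q r s) (iaxis u)"
      using P(1) Q(1) by (simp flip: R add: mob_mult)
    then show "t \<in> {min \<alpha> \<beta>..max \<alpha> \<beta>}"
      unfolding \<alpha>_def \<beta>_def using z(2) cmod_mob_iaxis[OF det] by (intro mediant_bounds[OF nz, of t u]) simp
  qed
  then have "length_on_line m (orth_projection m l) \<le> emeasure lborel {min \<alpha> \<beta>..max \<alpha> \<beta>}"
    unfolding length_on_line_def c_def[symmetric] by (intro emeasure_mono) auto
  also have "\<dots> = ennreal \<bar>\<beta> - \<alpha>\<bar>" by (simp add: min_def max_def)
  also have "\<beta> - \<alpha> = ln \<bar>(p * s) / (q * r)\<bar>"
    using nz by (simp add: \<alpha>_def \<beta>_def ln_div ln_mult abs_mult)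
  also have "(p * s) / (q * r) = (1 + w) / w" unfolding ps w_def ..
  also have "ennreal \<bar>ln \<bar>(1 + w) / w\<bar>\<bar> < ennreal (len_\<gamma> + len_\<delta>)"
    using bound by (simp add: ennreal_less_iff)
  finally show ?thesis .
qed

end
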